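(* Let $d\ge2$, $\alpha>d/2$ and $\beta\in\mathbb{R}$. There is a constant $c>0$ independent of $n$ such that for all $n\ge2$, $$e_n\big(\mathrm{H}^{\alpha,\beta}(\mathbb{S}^d)\big)\ge c\, n^{-\alpha/d}(\ln n)^{-\beta}.$$
   Context: Let $d\ge2$, let $\mathbb{S}^d$ be the unit sphere in $\mathbb{R}^{d+1}$, and let $\sigma_d$ be its normalized surface measure ($\sigma_d(\mathbb{S}^d)=1$). Let $L_2=L_2(\mathbb{S}^d,\sigma_d)$. Let $H_\ell(f)$ be the $L_2$-orthogonal projection of $f$ onto the space $\mathcal{H}^d_\ell$ of spherical harmonics of degree $\ell$. For $\alpha>0$ and $\beta\in\mathbb{R}$ let $\lambda^{(\alpha,\beta)}_\ell=(1+\ell(\ell+d-1))^{-\alpha/2}(\ln(3+\ell(\ell+d-1)))^{-\beta}$. Define $$\mathrm{H}^{\alpha,\beta}(\mathbb{S}^d)=\Big\{f\in L_2:\ \|f\|^2_{\mathrm{H}^{\alpha,\beta}}=\sum_{\ell\ge0}(\lambda^{(\alpha,\beta)}_\ell)^{-2}\|H_\ell(f)\|_{L_2}^2<\infty\Big\}.$$ For $\alpha>d/2$ this is a reproducing kernel Hilbert space of continuous functions. For such a space $H$, the $n$-th optimal quadrature error is $$e_n(H)=\inf_{c\in\mathbb{R}^n,\ x_1,\dots,x_n\in\mathbb{S}^d}\ \sup_{\|f\|_H\le1}\Big|\int_{\mathbb{S}^d}f\,d\sigma_d-\sum_{j=1}^n c_jf(x_j)\Big|.$$ *)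

theory Defs
  imports "HOL-Analysis.Analysis"
begin

text \<open>Ambient space R^(d+1) is real^'n with d = CARD('n) - 1.\<close>

definition sph_dim :: "'n::finite itself \<Rightarrow> nat" where
  "sph_dim _ = CARD('n) - 1"

text \<open>Normalized surface measure on the unit sphere: push-forward of the normalized
  Lebesgue measure on the closed unit ball under radial projection x / |x|
  (the cone-measure construction of the normalized surface measure).\<close>
definition sphere_measure :: "(real^'n::finite) measure" where
  "sphere_measure = distr (uniform_measure lborel (cball 0 1)) borel (\<lambda>x. x /\<^sub>R norm x)"

definition homog_poly :: "nat \<Rightarrow> (real^'n::finite \<Rightarrow> real) \<Rightarrow> bool" where
  "homog_poly l p \<longleftrightarrow> (\<exists>(A::('n \<Rightarrow> nat) set) (c::('n \<Rightarrow> nat) \<Rightarrow> real).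
      finite A \<and> (\<forall>a\<in>A. (\<Sum>i\<in>UNIV. a i) = l) \<and>
      p = (\<lambda>x. \<Sum>a\<in>A. c a * (\<Prod>i\<in>UNIV. (x $ i) ^ a i)))"

definition laplacian :: "(real^'n::finite \<Rightarrow> real) \<Rightarrow> real^'n \<Rightarrow> real" where
  "laplacian p x = (\<Sum>i\<in>UNIV.
      deriv (\<lambda>t. deriv (\<lambda>s. p (x + s *\<^sub>R axis i 1)) t) 0)"

text \<open>Space of spherical harmonics of degree l (as functions on real^'n; restriction to
  the sphere is implicit in how they are used).\<close>
definition sph_harm :: "nat \<Rightarrow> (real^'n::finite \<Rightarrow> real) set" where
  "sph_harm l = {p. homog_poly l p \<and> (\<forall>x. laplacian p x = 0)}"

definition harm_proj :: "nat \<Rightarrow> (real^'n::finite \<Rightarrow> real) \<Rightarrow> (real^'n \<Rightarrow> real)" where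
  "harm_proj l f = (THE g. g \<in> sph_harm l \<and>
      (\<forall>h\<in>sph_harm l. (LINT x|sphere_measure. (f x - g x) * h x) = 0))"

definition L2sq :: "(real^'n::finite \<Rightarrow> real) \<Rightarrow> real" where
  "L2sq f = (LINT x|sphere_measure. (f x)^2)"

definition lam :: "'n::finite itself \<Rightarrow> real \<Rightarrow> real \<Rightarrow> nat \<Rightarrow> real" where
  "lam T \<alpha> \<beta> l = (let m = real l * (real l + real (sph_dim T) - 1) in
      (1 + m) powr (-\<alpha>/2) * (ln (3 + m)) powr (-\<beta>))"

text \<open>Squared norm of H^{alpha,beta} is sum_l lam_l^(-2) ||H_l f||^2. The unit ball consists of
  continuous functions on the sphere (for alpha > d/2 every element of the space has a
  continuous representative, on which point evaluation acts). Functions are taken continuous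
  on all of real^'n; by Tietze extension their restrictions to the sphere are exactly the
  continuous functions on the sphere, and only sphere values enter the definitions.\<close>
definition H_unit_ball :: "'n::finite itself \<Rightarrow> real \<Rightarrow> real \<Rightarrow> (real^'n \<Rightarrow> real) set" where
  "H_unit_ball T \<alpha> \<beta> = {f. continuous_on UNIV f \<and>
      summable (\<lambda>l. (lam T \<alpha> \<beta> l)\<^sup>2 powr (-1) * L2sq (harm_proj l f)) \<and>
      (\<Sum>l. (lam T \<alpha> \<beta> l)\<^sup>2 powr (-1) * L2sq (harm_proj l f)) \<le> 1}"

definition quad_error :: "'n::finite itself \<Rightarrow> real \<Rightarrow> real \<Rightarrow> nat \<Rightarrow> ereal" where
  "quad_error T \<alpha> \<beta> n =
     (INF cx \<in> {(c :: nat \<Rightarrow> real, x :: nat \<Rightarrow> real^'n). \<forall>j<n. x j \<in> sphere 0 1}.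
        (SUP f \<in> H_unit_ball T \<alpha> \<beta>.
           ereal \<bar>(LINT y|sphere_measure. f y) - (\<Sum>j<n. fst cx j * f (snd cx j))\<bar>))"

end

theory Submission
  imports Defs "HOL-Library.Function_Algebras"
begin

text \<open>The fooling function is a polynomial. Let \<open>K\<close> be the reproducing kernel in \<open>L\<^sub>2\<close> of the
  homogeneous polynomials of degree \<open>N\<close> on the sphere. By rotation invariance its diagonal is
  constant, equal to the dimension \<open>D\<close>, which is at least of order \<open>N\<^sup>d\<close>. Subtracting the kernel of
  \<open>span {K(x\<^sub>j, -) | j < n}\<close> leaves on the diagonal a polynomial \<open>q\<close> of degree \<open>2 N\<close> with \<open>0 \<le> q \<le> D\<close>
  that vanishes at all nodes and has integral at least \<open>D - n\<close>. Choosing \<open>N\<close> of order \<open>n\<close> to the power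
  \<open>1/d\<close> with \<open>D \<ge> 2 n\<close>, the function \<open>q / D\<close> has integral at least \<open>1/2\<close> and \<open>L\<^sub>2\<close> norm at most \<open>1\<close>. Since only
  degrees up to \<open>2 N\<close> contribute, Bessel's inequality bounds its norm in the Sobolev type space by
  the maximum of \<open>1 / \<lambda>\<^sub>l\<close> over \<open>l \<le> 2 N\<close>. That spherical harmonics of degree \<open>l\<close> are orthogonal to all
  polynomials of lower degree follows from integration by parts on the sphere, which is itself a
  consequence of rotation invariance.\<close>

section \<open>The normalized surface measure\<close>

lemma lborel_nn_integral_translate:
  fixes f :: "'a::euclidean_space \<Rightarrow> ennreal"
  assumes [measurable]: "f \<in> borel_measurable borel"
  shows "(\<integral>\<^sup>+x. f (c + x) \<partial>lborel) = (\<integral>\<^sup>+x. f x \<partial>lborel)"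
proof -
  have "distr lborel borel (\<lambda>x. c + x) = (lborel :: 'a measure)"
    by (subst lborel_affine[of 1 c]) (auto simp: density_1)
  then have "(\<integral>\<^sup>+x. f x \<partial>lborel) = (\<integral>\<^sup>+x. f x \<partial>distr lborel borel (\<lambda>x. c + x))"
    by simp
  also have "\<dots> = (\<integral>\<^sup>+x. f (c + x) \<partial>lborel)"
    by (subst nn_integral_distr) auto
  finally show ?thesis ..
qed

lemma orthogonal_transformation_measurable:
  fixes T :: "'a::euclidean_space \<Rightarrow> 'a"
  assumes "orthogonal_transformation T"
  shows "T \<in> borel_measurable borel"
  using assms by (intro borel_measurable_continuous_onI linear_continuous_on)
    (auto simp: orthogonal_transformation_linear linear_linear)

text \<open>The library proves the invariance of Lebesgue measure under orthogonal maps only for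
  well-ordered index types. Here it is obtained from translation invariance alone, by
  applying Tonelli to the indicator of \<open>{(x, y). norm x \<le> 1 \<and> y + T x \<in> B}\<close>.\<close>
lemma lborel_distr_orthogonal:
  fixes T :: "'a::euclidean_space \<Rightarrow> 'a"
  assumes T: "orthogonal_transformation T"
  shows "distr lborel borel T = lborel"
proof (rule measure_eqI)
  define S where "S = inv T"
  have bT: "bij T" using T by (rule orthogonal_transformation_bij)
  have S: "orthogonal_transformation S"
    unfolding S_def using T by (rule orthogonal_transformation_inv)
  note [measurable] = orthogonal_transformation_measurable[OF T] orthogonal_transformation_measurable[OF S]
  have TS: "T (S y) = y" for y
    unfolding S_def using bT by (simp add: bij_is_surj surj_f_inv_f)
  have Tadd: "T (x + y) = T x + T y" for x y
    using T by (simp add: linear_add orthogonal_transformation_linear)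
  have Tneg: "T (- x) = - T x" for x
    using T by (simp add: linear_neg orthogonal_transformation_linear)
  have Tdiff: "T (x - y) = T x - T y" for x y
    using T by (simp add: linear_diff orthogonal_transformation_linear)
  fix B :: "'a set" assume "B \<in> sets (distr lborel borel T)"
  then have [measurable]: "B \<in> sets borel" by simp
  define a where "a = (indicator (cball 0 1) :: 'a \<Rightarrow> ennreal)"
  have [measurable]: "a \<in> borel_measurable borel"
    unfolding a_def by (intro borel_measurable_indicator) auto
  let ?b = "indicator B :: 'a \<Rightarrow> ennreal"
  let ?v = "emeasure lborel (cball 0 1 :: 'a set)"
  have inta: "(\<integral>\<^sup>+x. a x \<partial>lborel) = ?v" unfolding a_def by simp
  have "?v * emeasure lborel B = (\<integral>\<^sup>+x. a x * emeasure lborel B \<partial>lborel)"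
    by (simp add: nn_integral_multc inta)
  also have "\<dots> = (\<integral>\<^sup>+x. (\<integral>\<^sup>+y. a x * ?b (T x + y) \<partial>lborel) \<partial>lborel)"
    by (intro nn_integral_cong) (simp add: nn_integral_cmult lborel_nn_integral_translate)
  also have "\<dots> = (\<integral>\<^sup>+y. (\<integral>\<^sup>+x. a x * ?b (T x + y) \<partial>lborel) \<partial>lborel)"
    by (rule lborel_pair.Fubini') (measurable)
  \<comment> \<open>Translating \<open>x\<close> by \<open>- S y\<close> turns
    \<open>T x + y\<close> into \<open>T x\<close>, because \<open>T (S y) = y\<close>; afterwards
    \<open>y\<close> occurs only in the indicator of the ball.\<close>
  also have "\<dots> = (\<integral>\<^sup>+y. (\<integral>\<^sup>+x. a (- S y + x) * ?b (T x) \<partial>lborel) \<partial>lborel)"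
  proof (rule nn_integral_cong)
    fix y
    show "(\<integral>\<^sup>+x. a x * ?b (T x + y) \<partial>lborel) = (\<integral>\<^sup>+x. a (- S y + x) * ?b (T x) \<partial>lborel)"
      using lborel_nn_integral_translate[of "\<lambda>x. a x * ?b (T x + y)" "- S y"]
      by (simp add: Tadd Tdiff Tneg TS)
  qed
  also have "\<dots> = (\<integral>\<^sup>+x. (\<integral>\<^sup>+y. a (- S y + x) * ?b (T x) \<partial>lborel) \<partial>lborel)"
    by (rule lborel_pair.Fubini') (measurable)
  \<comment> \<open>Since \<open>T\<close> preserves norms, the ball can be read as a ball in
    \<open>y\<close> centred at \<open>T x\<close>, so that the inner integral becomes its volume
    \<open>?v\<close>.\<close>
  also have "\<dots> = (\<integral>\<^sup>+x. (\<integral>\<^sup>+y. ?b (T x) * a (- T x + y) \<partial>lborel) \<partial>lborel)"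
  proof (intro nn_integral_cong)
    fix x y
    have "norm (- S y + x) = norm (T (- S y + x))"
      using T by (simp add: orthogonal_transformation_norm)
    also have "\<dots> = norm (- T x + y)"
      by (simp add: Tdiff TS norm_minus_commute)
    finally show "a (- S y + x) * ?b (T x) = ?b (T x) * a (- T x + y)"
      unfolding a_def by (simp add: indicator_def)
  qed
  also have "\<dots> = (\<integral>\<^sup>+x. ?b (T x) * ?v \<partial>lborel)"
    using lborel_nn_integral_translate[of a] inta
    by (intro nn_integral_cong) (simp add: nn_integral_cmult del: add_uminus_conv_diff uminus_add_conv_diff)
  also have "\<dots> = ?v * emeasure (distr lborel borel T) B"
  proof -
    have "(\<integral>\<^sup>+x. ?b (T x) \<partial>lborel) = (\<integral>\<^sup>+x. ?b x \<partial>distr lborel borel T)"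
      by (rule nn_integral_distr[symmetric]) auto
    then show ?thesis by (simp add: nn_integral_multc mult.commute)
  qed
  finally have *: "?v * emeasure (distr lborel borel T) B = ?v * emeasure lborel B" ..
  moreover have "?v \<noteq> 0" "?v \<noteq> \<infinity>"
    using unit_ball_vol_pos[of "real DIM('a)"] by (auto simp: emeasure_cball simp del: unit_ball_vol_pos)
  ultimately show "emeasure (distr lborel borel T) B = emeasure lborel B"
    by (simp add: ennreal_mult_cancel_left)
qed simp

section \<open>Null sets, integration and rotation invariance for the surface measure\<close>

lemma sets_sphere_measure [measurable_cong, simp]: "sets sphere_measure = sets borel"
  and space_sphere_measure [simp]: "space sphere_measure = UNIV"
  by (simp_all add: sphere_measure_def)

lemma normalize_measurable [measurable]:
  "(\<lambda>x::real^'n. x /\<^sub>R norm x) \<in> borel_measurable borel"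
  by measurable

lemma unit_ball_emeasure:
  "emeasure lborel (cball 0 1 :: (real^'n) set) \<noteq> 0"
  "emeasure lborel (cball 0 1 :: (real^'n) set) \<noteq> \<infinity>"
  using unit_ball_vol_pos[of "real CARD('n)"] by (auto simp: emeasure_cball simp del: unit_ball_vol_pos)

lemma prob_sphere_measure: "emeasure sphere_measure (UNIV :: (real^'n) set) = 1"
  unfolding sphere_measure_def
  using unit_ball_emeasure[where 'n='n] by (subst emeasure_distr) (auto simp: ennreal_divide_self less_top)

interpretation sphere_measure: finite_measure "sphere_measure :: (real^'n) measure"
  by standard (simp add: prob_sphere_measure)

lemma AE_sphere_measure:
  assumes [measurable]: "Measurable.pred borel P"
  shows "(AE x in sphere_measure. P x) \<longleftrightarrow>
    (AE x in lborel. x \<in> cball 0 1 \<longrightarrow> P ((x::real^'n) /\<^sub>R norm x))"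
proof -
  have "(AE x in sphere_measure. P x) \<longleftrightarrow> (AE x in uniform_measure lborel (cball 0 1). P ((x::real^'n) /\<^sub>R norm x))"
    unfolding sphere_measure_def by (subst AE_distr_iff) auto
  then show ?thesis
    using unit_ball_emeasure by (subst (asm) AE_uniform_measure) (auto simp: less_top)
qed

text \<open>Radial projection sends every nonzero point to the sphere; the origin, which the
  convention for division by zero sends to itself, is a Lebesgue null set.\<close>

lemma AE_in_sphere: "AE x in sphere_measure. (x::real^'n) \<in> sphere 0 1"
proof -
  have "AE x in lborel. (x::real^'n) \<noteq> 0"
    by (rule AE_lborel_singleton)
  then show ?thesis
    by (subst AE_sphere_measure) (auto elim!: eventually_mono)
qed

text \<open>Continuity gives a bound on the compact sphere, and the sphere carries all of the finite
  measure.\<close>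

lemma integrable_sphere_measure:
  fixes f :: "real^'n \<Rightarrow> real"
  assumes "continuous_on UNIV f"
  shows "integrable sphere_measure f"
proof -
  have [measurable]: "f \<in> borel_measurable borel"
    using assms by (rule borel_measurable_continuous_onI)
  have "compact (f ` sphere 0 1)"
    using assms by (intro compact_continuous_image) (auto intro: continuous_on_subset)
  then obtain B where "\<forall>y\<in>f ` sphere 0 1. norm y \<le> B"
    by (meson bounded_iff compact_imp_bounded)
  then show ?thesis
    using AE_in_sphere by (intro sphere_measure.integrable_const_bound[of _ B]) (auto elim!: eventually_mono)
qed

lemma integral_sphere_cong:
  fixes f g :: "real^'n \<Rightarrow> real"
  assumes "continuous_on UNIV f" "continuous_on UNIV g" "\<And>x. norm x = 1 \<Longrightarrow> f x = g x"
  shows "(LINT x|sphere_measure. f x) = (LINT x|sphere_measure. g x)"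
  using AE_in_sphere assms(3)
  by (intro integral_cong_AE)
    (auto intro: borel_measurable_integrable integrable_sphere_measure assms elim!: eventually_mono)

lemma integral_sphere_mono:
  fixes f g :: "real^'n \<Rightarrow> real"
  assumes "continuous_on UNIV f" "continuous_on UNIV g" "\<And>x. norm x = 1 \<Longrightarrow> f x \<le> g x"
  shows "(LINT x|sphere_measure. f x) \<le> (LINT x|sphere_measure. g x)"
  using AE_in_sphere assms(3)
  by (intro integral_mono_AE)
    (auto intro: borel_measurable_integrable integrable_sphere_measure assms elim!: eventually_mono)

lemma integral_sphere_const: "(LINT x|(sphere_measure :: (real^'n) measure). c) = (c::real)"
  using prob_sphere_measure[where 'n='n] by (simp add: measure_def)

text \<open>Radial projection commutes with \<open>T\<close> and the ball is
  \<open>T\<close>-invariant, so the claim reduces to the invariance of Lebesgue measure.\<close>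

lemma integral_sphere_orthogonal:
  fixes T :: "real^'n \<Rightarrow> real^'n" and f :: "real^'n \<Rightarrow> real"
  assumes T: "orthogonal_transformation T" and f: "continuous_on UNIV f"
  shows "(LINT x|sphere_measure. f (T x)) = (LINT x|sphere_measure. f x)"
proof -
  note [measurable] = orthogonal_transformation_measurable[OF T]
  have [measurable]: "f \<in> borel_measurable borel"
    using f by (rule borel_measurable_continuous_onI)
  let ?I = "indicator (cball 0 1) :: real^'n \<Rightarrow> real"
  \<comment> \<open>Writing the sphere integral as a weighted Lebesgue integral makes the change of
    variables available.\<close>
  have eq: "(LINT x|sphere_measure. g x) =
    (LINT x|lborel. (?I x / measure lborel (cball 0 1 :: (real^'n) set)) * g (x /\<^sub>R norm x))"
    if [measurable]: "g \<in> borel_measurable borel" for g :: "real^'n \<Rightarrow> real"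
  proof -
    have "uniform_measure lborel (cball 0 1 :: (real^'n) set) =
       density lborel (\<lambda>x. ennreal (?I x / measure lborel (cball 0 1 :: (real^'n) set)))"
      unfolding uniform_measure_def
      using unit_ball_emeasure[where 'n='n]
      by (intro density_cong)
        (auto simp: indicator_def emeasure_eq_ennreal_measure divide_ennreal zero_less_iff_neq_zero[symmetric] simp flip: ennreal_1)
    then have "(LINT x|sphere_measure. g x) = (LINT x|density lborel
        (\<lambda>x. ennreal (?I x / measure lborel (cball 0 1 :: (real^'n) set))). g (x /\<^sub>R norm x))"
      unfolding sphere_measure_def by (simp add: integral_distr)
    also have "\<dots> = (LINT x|lborel. (?I x / measure lborel (cball 0 1 :: (real^'n) set)) * g (x /\<^sub>R norm x))"
      by (rule integral_real_density) (auto intro!: borel_measurable_divide borel_measurable_indicator)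
    finally show ?thesis .
  qed
  have "(LINT x|sphere_measure. f x) = (LINT x|distr lborel borel T.
     (?I x / measure lborel (cball 0 1 :: (real^'n) set)) * f (x /\<^sub>R norm x))"
    by (simp add: eq lborel_distr_orthogonal[OF T])
  also have "\<dots> = (LINT x|lborel. (?I (T x) / measure lborel (cball 0 1 :: (real^'n) set)) * f (T x /\<^sub>R norm (T x)))"
    by (subst integral_distr)
      (auto intro!: borel_measurable_divide borel_measurable_times borel_measurable_indicator)
  also have "\<dots> = (LINT x|lborel. (?I x / measure lborel (cball 0 1 :: (real^'n) set)) * f (T (x /\<^sub>R norm x)))"
    using T by (simp add: orthogonal_transformation_norm orthogonal_transformation_scaleR indicator_def)
  also have "\<dots> = (LINT x|sphere_measure. f (T x))"
    by (subst eq) auto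
  finally show ?thesis ..
qed

section \<open>Homogeneous polynomials\<close>

text \<open>The same class as \<open>homog_poly\<close> (see \<open>homog_poly_iff_hpoly\<close>),
  generated so that closure properties and derivatives follow by rule induction instead of
  manipulation of multi-indices.\<close>

inductive hpoly :: "nat \<Rightarrow> (real^'n::finite \<Rightarrow> real) \<Rightarrow> bool" where
  const: "hpoly 0 (\<lambda>x. c)"
| coord: "hpoly l p \<Longrightarrow> hpoly (Suc l) (\<lambda>x. x $ i * p x)"
| add: "hpoly l p \<Longrightarrow> hpoly l q \<Longrightarrow> hpoly l (\<lambda>x. p x + q x)"

lemma hpoly_scale: "hpoly l p \<Longrightarrow> hpoly l (\<lambda>x. c * p x)"
proof (induction rule: hpoly.induct)
  case (coord l p i)
  then show ?case using hpoly.coord[of l "\<lambda>x. c * p x" i] by (simp add: algebra_simps)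
next
  case (add l p q)
  then show ?case using hpoly.add[of l "\<lambda>x. c * p x" "\<lambda>x. c * q x"] by (simp add: algebra_simps)
qed (rule hpoly.const)

lemma hpoly_coordinate: "hpoly (Suc 0) (\<lambda>x. x $ i)"
  using hpoly.coord[OF hpoly.const[of 1], of i] by simp

lemma hpoly_zero: "hpoly l (\<lambda>x. 0)"
proof (induction l)
  case (Suc l)
  then show ?case using hpoly.coord[of l "\<lambda>x. 0"] by simp
qed (rule hpoly.const)

lemma hpoly_uminus: "hpoly l p \<Longrightarrow> hpoly l (\<lambda>x. - p x)"
  using hpoly_scale[of l p "-1"] by simp

lemma hpoly_diff: "hpoly l p \<Longrightarrow> hpoly l q \<Longrightarrow> hpoly l (\<lambda>x. p x - q x)"
  using hpoly.add[of l p "\<lambda>x. - q x"] hpoly_uminus[of l q] by simp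

lemma hpoly_sum: "(\<And>i. i \<in> I \<Longrightarrow> hpoly l (p i)) \<Longrightarrow> hpoly l (\<lambda>x. \<Sum>i\<in>I. p i x)"
  by (induction I rule: infinite_finite_induct) (auto intro: hpoly_zero hpoly.add)

lemma hpoly_mult:
  assumes "hpoly k p" "hpoly l q" shows "hpoly (k + l) (\<lambda>x. p x * q x)"
  using assms
proof (induction rule: hpoly.induct)
  case (const c)
  then show ?case by (simp add: hpoly_scale)
next
  case (coord k p i)
  then show ?case using hpoly.coord[of "k + l" "\<lambda>x. p x * q x" i] by (simp add: algebra_simps)
next
  case (add k p r)
  then show ?case using hpoly.add[of "k + l" "\<lambda>x. p x * q x" "\<lambda>x. r x * q x"] by (simp add: algebra_simps)
qed

lemma hpoly_prod:
  assumes "finite I" "\<And>i. i \<in> I \<Longrightarrow> hpoly (k i) (p i)"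
  shows "hpoly (\<Sum>i\<in>I. k i) (\<lambda>x. \<Prod>i\<in>I. p i x)"
  using assms by (induction I) (auto intro: hpoly.const hpoly_mult)

lemma hpoly_power: "hpoly l p \<Longrightarrow> hpoly (m * l) (\<lambda>x. p x ^ m)"
  by (induction m) (auto intro: hpoly.const hpoly_mult)

lemma continuous_on_hpoly: "hpoly l p \<Longrightarrow> continuous_on A p"
  by (induction rule: hpoly.induct) (auto intro!: continuous_intros)

lemma hpoly_scaleR: "hpoly l p \<Longrightarrow> p (t *\<^sub>R x) = t ^ l * p x"
  by (induction rule: hpoly.induct) (auto simp: algebra_simps)

text \<open>Homogeneity recovers a value from the sphere along its ray; at the origin any unit
  vector serves. This upgrades identities on the sphere, all that integrals can see, to identities
  of functions.\<close>

lemma hpoly_eqI: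
  fixes p q :: "real^'n \<Rightarrow> real"
  assumes "hpoly l p" "hpoly l q" "\<And>x. norm x = 1 \<Longrightarrow> p x = q x"
  shows "p = q"
proof
  fix x
  obtain u :: "real^'n" where u: "norm u = 1"
    using norm_axis_1 by blast
  define y where "y = (if x = 0 then u else x /\<^sub>R norm x)"
  have y: "norm y = 1" "x = norm x *\<^sub>R y"
    using u by (auto simp: y_def)
  have "r x = norm x ^ l * r y" if "hpoly l r" for r
    using hpoly_scaleR[OF that, of "norm x" y] y(2) by metis
  then show "p x = q x" using assms y(1) by metis
qed

text \<open>Each coordinate of \<open>T x\<close> is a linear form in \<open>x\<close>, so
  multiplication by a coordinate becomes multiplication by a polynomial of degree 1.\<close>

lemma hpoly_linear:
  assumes T: "linear (T :: real^'n \<Rightarrow> real^'n)" and p: "hpoly l p"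
  shows "hpoly l (\<lambda>x. p (T x))"
  using p
proof (induction rule: hpoly.induct)
  case (coord l p i)
  have eq: "T x $ i = (\<Sum>j\<in>UNIV. T (axis j 1) $ i * x $ j)" for x
  proof -
    have "T x = T (\<Sum>j\<in>UNIV. x $ j *\<^sub>R axis j 1)"
      by (simp only: basis_expansion flip: scalar_mult_eq_scaleR)
    also have "\<dots> = (\<Sum>j\<in>UNIV. x $ j *\<^sub>R T (axis j 1))"
      using T by (simp add: linear_sum linear_scale)
    finally show ?thesis by (simp add: mult.commute)
  qed
  have "hpoly (Suc 0) (\<lambda>x. \<Sum>j\<in>UNIV. T (axis j 1) $ i * x $ j)"
    by (intro hpoly_sum hpoly_scale hpoly_coordinate)
  then have "hpoly (Suc 0) (\<lambda>x. T x $ i)"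
    by (rule back_subst[where P = "hpoly (Suc 0)"]) (rule ext, rule eq[symmetric])
  from hpoly_mult[OF this coord.IH] show ?case by simp
qed (auto intro: hpoly.intros)

lemma homog_poly_iff_hpoly: "homog_poly l p \<longleftrightarrow> hpoly l p"
proof
  assume "homog_poly l p"
  then obtain A c where A: "finite A" "\<And>a. a \<in> A \<Longrightarrow> (\<Sum>i\<in>UNIV. a i) = l"
    and p: "p = (\<lambda>x. \<Sum>a\<in>A. c a * (\<Prod>i\<in>UNIV. (x $ i) ^ a i))"
    unfolding homog_poly_def by auto
  have "hpoly l (\<lambda>x::real^'a. \<Prod>i\<in>UNIV. (x $ i) ^ a i)" if "a \<in> A" for a
  proof -
    have "hpoly (a i) (\<lambda>x::real^'a. (x $ i) ^ a i)" for i
      using hpoly_power[OF hpoly_coordinate, of "a i"] by simp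
    then have "hpoly (\<Sum>i\<in>UNIV. a i) (\<lambda>x::real^'a. \<Prod>i\<in>UNIV. (x $ i) ^ a i)"
      by (intro hpoly_prod) auto
    then show ?thesis using A(2)[OF that] by simp
  qed
  then show "hpoly l p"
    unfolding p by (intro hpoly_sum hpoly_scale)
next
  assume "hpoly l p"
  then show "homog_poly l p"
  proof (induction rule: hpoly.induct)
    case (const c)
    show ?case unfolding homog_poly_def
      by (intro exI[of _ "{\<lambda>i. 0}"] exI[of _ "\<lambda>a. c"]) auto
  next
    case (coord l p j)
    then obtain A c where A: "finite A" "\<And>a. a \<in> A \<Longrightarrow> (\<Sum>i\<in>UNIV. a i) = l"
      and p: "p = (\<lambda>x. \<Sum>a\<in>A. c a * (\<Prod>i\<in>UNIV. (x $ i) ^ a i))"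
      unfolding homog_poly_def by auto
    \<comment> \<open>Multiplication by \<open>x $ j\<close> shifts multi-indices by
      \<open>s\<close>; injectivity of \<open>s\<close> lets the coefficients be carried over
      through \<open>inv s\<close>.\<close>
    define s where "s = (\<lambda>a::'a \<Rightarrow> nat. a(j := Suc (a j)))"
    have inj: "inj s"
    proof (rule injI)
      fix a b assume "s a = s b"
      then have "s a i = s b i" for i by simp
      then show "a = b" unfolding s_def fun_upd_def by (metis ext nat.inject)
    qed
    have mono: "(\<Prod>i\<in>UNIV. (x $ i) ^ s a i) = x $ j * (\<Prod>i\<in>UNIV. (x $ i) ^ a i)" for a and x :: "real^'a"
      by (simp add: s_def prod.remove[of UNIV j] algebra_simps)
    have deg: "(\<Sum>i\<in>UNIV. s a i) = Suc (\<Sum>i\<in>UNIV. a i)" for a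
      by (simp add: s_def sum.remove[of UNIV j])
    have "(\<lambda>x. x $ j * p x) = (\<lambda>x. \<Sum>a\<in>s ` A. c (inv s a) * (\<Prod>i\<in>UNIV. (x $ i) ^ a i))"
      unfolding p using inj
      by (subst sum.reindex) (auto simp: inj_on_def inj_def mono sum_distrib_left algebra_simps)
    then show ?case
      unfolding homog_poly_def using A deg
      by (intro exI[of _ "s ` A"] exI[of _ "\<lambda>a. c (inv s a)"]) auto
  next
    case (add l p q)
    then obtain A c B d where A: "finite A" "\<And>a. a \<in> A \<Longrightarrow> (\<Sum>i\<in>UNIV. a i) = l"
      and p: "p = (\<lambda>x. \<Sum>a\<in>A. c a * (\<Prod>i\<in>UNIV. (x $ i) ^ a i))"
      and B: "finite B" "\<And>a. a \<in> B \<Longrightarrow> (\<Sum>i\<in>UNIV. a i) = l"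
      and q: "q = (\<lambda>x. \<Sum>a\<in>B. d a * (\<Prod>i\<in>UNIV. (x $ i) ^ a i))"
      unfolding homog_poly_def by auto
    let ?c = "\<lambda>a. (if a \<in> A then c a else 0) + (if a \<in> B then d a else 0)"
    have "p x = (\<Sum>a\<in>A \<union> B. (if a \<in> A then c a else 0) * (\<Prod>i\<in>UNIV. (x $ i) ^ a i))" for x
      unfolding p using A B by (intro sum.mono_neutral_cong_left) auto
    moreover have "q x = (\<Sum>a\<in>A \<union> B. (if a \<in> B then d a else 0) * (\<Prod>i\<in>UNIV. (x $ i) ^ a i))" for x
      unfolding q using A B by (intro sum.mono_neutral_cong_left) auto
    ultimately have "(\<lambda>x. p x + q x) = (\<lambda>x. \<Sum>a\<in>A \<union> B. ?c a * (\<Prod>i\<in>UNIV. (x $ i) ^ a i))"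
      by (simp add: sum.distrib[symmetric] algebra_simps)
    then show ?case
      unfolding homog_poly_def using A B by (intro exI[of _ "A \<union> B"] exI[of _ ?c]) auto
  qed
qed

section \<open>Partial derivatives, Euler's identity and the Laplacian\<close>

definition pd :: "'n::finite \<Rightarrow> (real^'n \<Rightarrow> real) \<Rightarrow> real^'n \<Rightarrow> real" where
  "pd i p x = deriv (\<lambda>s. p (x + s *\<^sub>R axis i 1)) 0"

text \<open>The gradient is first an abstract family \<open>g\<close>, built along the induction by
  the sum and product rules. Only once differentiability is known can it be identified with
  \<open>pd\<close>, which is defined through \<open>deriv\<close>.\<close>

lemma hpoly_derivative_exists:
  assumes "hpoly l p"
  shows "\<exists>g. (\<forall>i. (l = 0 \<longrightarrow> g i = (\<lambda>x. 0)) \<and> (\<forall>m. l = Suc m \<longrightarrow> hpoly m (g i))) \<and>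
    (\<forall>x. (p has_derivative (\<lambda>h. \<Sum>i\<in>UNIV. h $ i * g i x)) (at x)) \<and>
    (\<forall>x. (\<Sum>i\<in>UNIV. x $ i * g i x) = real l * p x)"
  using assms
proof (induction rule: hpoly.induct)
  case (const c)
  show ?case by (rule exI[of _ "\<lambda>i x. 0"]) simp
next
  case (coord l p j)
  from coord.IH obtain g where g:
    "\<forall>i. (l = 0 \<longrightarrow> g i = (\<lambda>x. 0)) \<and> (\<forall>m. l = Suc m \<longrightarrow> hpoly m (g i))"
    "\<forall>x. (p has_derivative (\<lambda>h. \<Sum>i\<in>UNIV. h $ i * g i x)) (at x)"
    "\<forall>x. (\<Sum>i\<in>UNIV. x $ i * g i x) = real l * p x"
    by (elim exE conjE) (rule that)
  let ?g = "\<lambda>i x. (if i = j then 1 else 0) * p x + x $ j * g i x"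
  have sum: "(\<Sum>i\<in>UNIV. h $ i * ?g i x) = h $ j * p x + x $ j * (\<Sum>i\<in>UNIV. h $ i * g i x)" for h x
  proof -
    have "(\<Sum>i\<in>UNIV. h $ i * ?g i x) = (\<Sum>i\<in>UNIV. (if i = j then h $ i * p x else 0) + x $ j * (h $ i * g i x))"
      by (intro sum.cong) (auto simp: algebra_simps)
    then show ?thesis by (simp add: sum.distrib sum_distrib_left)
  qed
  have hom: "hpoly l (?g i)" for i
  proof (cases l)
    case 0
    then have "g i x = 0" for x using g(1) by simp
    then show ?thesis using hpoly_scale[OF coord.hyps, of "if i = j then 1 else 0"] by simp
  next
    case (Suc m)
    then have "hpoly m (g i)" using g(1) by simp
    then have "hpoly l (\<lambda>x. x $ j * g i x)" using Suc hpoly.coord by simp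
    with hpoly_scale[OF coord.hyps] show ?thesis by (rule hpoly.add)
  qed
  have der: "((\<lambda>x. x $ j * p x) has_derivative (\<lambda>h. \<Sum>i\<in>UNIV. h $ i * ?g i x)) (at x)" for x
  proof -
    have "((\<lambda>x. x $ j * p x) has_derivative
        (\<lambda>h. x $ j * (\<Sum>i\<in>UNIV. h $ i * g i x) + h $ j * p x)) (at x)"
      by (intro has_derivative_mult spec[OF g(2)] bounded_linear_imp_has_derivative bounded_linear_vec_nth)
    then show ?thesis unfolding sum by (simp only: add.commute)
  qed
  have euler: "(\<Sum>i\<in>UNIV. x $ i * ?g i x) = real (Suc l) * (x $ j * p x)" for x
    unfolding sum spec[OF g(3)] by (simp add: algebra_simps)
  show ?case
    by (intro exI[of _ ?g] conjI allI impI der euler) (use hom in simp_all)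
next
  case (add l p q)
  from add.IH(1) obtain g where g:
    "\<forall>i. (l = 0 \<longrightarrow> g i = (\<lambda>x. 0)) \<and> (\<forall>m. l = Suc m \<longrightarrow> hpoly m (g i))"
    "\<forall>x. (p has_derivative (\<lambda>h. \<Sum>i\<in>UNIV. h $ i * g i x)) (at x)"
    "\<forall>x. (\<Sum>i\<in>UNIV. x $ i * g i x) = real l * p x"
    by (elim exE conjE) (rule that)
  from add.IH(2) obtain h where h:
    "\<forall>i. (l = 0 \<longrightarrow> h i = (\<lambda>x. 0)) \<and> (\<forall>m. l = Suc m \<longrightarrow> hpoly m (h i))"
    "\<forall>x. (q has_derivative (\<lambda>k. \<Sum>i\<in>UNIV. k $ i * h i x)) (at x)"
    "\<forall>x. (\<Sum>i\<in>UNIV. x $ i * h i x) = real l * q x"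
    by (elim exE conjE) (rule that)
  show ?case
  proof (intro exI[of _ "\<lambda>i x. g i x + h i x"] conjI allI impI)
    show "((\<lambda>x. p x + q x) has_derivative (\<lambda>k. \<Sum>i\<in>UNIV. k $ i * (g i x + h i x))) (at x)" for x
      using has_derivative_add[OF spec[OF g(2)] spec[OF h(2)], of x] by (simp add: distrib_left sum.distrib)
    show "(\<Sum>i\<in>UNIV. x $ i * (g i x + h i x)) = real l * (p x + q x)" for x
      using spec[OF g(3), of x] spec[OF h(3), of x] by (simp add: distrib_left sum.distrib)
    show "(\<lambda>x. g i x + h i x) = (\<lambda>x. 0)" if "l = 0" for i
      using that g(1) h(1) by simp
    show "hpoly m (\<lambda>x. g i x + h i x)" if "l = Suc m" for i m
      using that g(1) h(1) by (intro hpoly.add) simp_all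
  qed
qed

lemma has_real_derivative_along_axis:
  assumes "(p has_derivative (\<lambda>h. \<Sum>i\<in>UNIV. h $ i * g i)) (at x)"
  shows "((\<lambda>s. p (x + s *\<^sub>R axis i 1)) has_real_derivative g i) (at 0)"
proof -
  have "((\<lambda>s. p (x + s *\<^sub>R axis i 1)) has_derivative (\<lambda>t. \<Sum>j\<in>UNIV. (t *\<^sub>R axis i 1) $ j * g j)) (at 0)"
    using assms by (intro has_derivative_compose[where g = p and f = "\<lambda>s. x + s *\<^sub>R axis i 1"])
      (auto intro!: derivative_eq_intros)
  moreover have "(\<lambda>t. \<Sum>j\<in>UNIV. (t *\<^sub>R axis i 1) $ j * g j) = (*) (g i)"
  proof
    fix t
    have "(\<Sum>j\<in>UNIV. (t *\<^sub>R axis i 1) $ j * g j) = (\<Sum>j\<in>UNIV. if j = i then t * g j else 0)"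
      by (intro sum.cong) (auto simp: axis_def)
    then show "(\<Sum>j\<in>UNIV. (t *\<^sub>R axis i 1) $ j * g j) = g i * t" by simp
  qed
  ultimately show ?thesis
    by (simp add: has_field_derivative_def)
qed

lemma pd_eqI:
  assumes "(p has_derivative (\<lambda>h. \<Sum>i\<in>UNIV. h $ i * g i)) (at x)"
  shows "pd i p x = g i"
  unfolding pd_def using has_real_derivative_along_axis[OF assms] by (rule DERIV_imp_deriv)

lemma hpoly_pd_aux:
  assumes "hpoly l p"
  shows "(\<forall>i. (l = 0 \<longrightarrow> pd i p = (\<lambda>x. 0)) \<and> (\<forall>m. l = Suc m \<longrightarrow> hpoly m (pd i p))) \<and>
    (\<forall>x. (p has_derivative (\<lambda>h. \<Sum>i\<in>UNIV. h $ i * pd i p x)) (at x)) \<and>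
    (\<forall>x. (\<Sum>i\<in>UNIV. x $ i * pd i p x) = real l * p x)"
proof -
  obtain g where g: "\<forall>i. (l = 0 \<longrightarrow> g i = (\<lambda>x. 0)) \<and> (\<forall>m. l = Suc m \<longrightarrow> hpoly m (g i))"
    "\<forall>x. (p has_derivative (\<lambda>h. \<Sum>i\<in>UNIV. h $ i * g i x)) (at x)"
    "\<forall>x. (\<Sum>i\<in>UNIV. x $ i * g i x) = real l * p x"
    using hpoly_derivative_exists[OF assms] by blast
  have "pd i p = g i" for i
    using g(2) by (intro ext pd_eqI[where g = "\<lambda>i. g i _"]) blast
  then show ?thesis using g by simp
qed

lemma pd_hpoly_0: "hpoly 0 p \<Longrightarrow> pd i p x = 0"
  and hpoly_pd: "hpoly (Suc l) p \<Longrightarrow> hpoly l (pd i p)"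
  and has_derivative_hpoly: "hpoly l p \<Longrightarrow> (p has_derivative (\<lambda>h. \<Sum>i\<in>UNIV. h $ i * pd i p x)) (at x)"
  and hpoly_euler: "hpoly l p \<Longrightarrow> (\<Sum>i\<in>UNIV. x $ i * pd i p x) = real l * p x"
  using hpoly_pd_aux[of 0 p] hpoly_pd_aux[of "Suc l" p] hpoly_pd_aux[of l p] by auto

lemma pd_mult:
  assumes "hpoly k p" "hpoly l q"
  shows "pd i (\<lambda>x. p x * q x) x = pd i p x * q x + p x * pd i q x"
proof (rule pd_eqI[where g = "\<lambda>i. pd i p x * q x + p x * pd i q x"])
  show "((\<lambda>x. p x * q x) has_derivative
      (\<lambda>h. \<Sum>i\<in>UNIV. h $ i * (pd i p x * q x + p x * pd i q x))) (at x)"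
    by (rule has_derivative_eq_rhs[OF has_derivative_mult[OF has_derivative_hpoly[OF assms(1)] has_derivative_hpoly[OF assms(2)]]])
      (simp add: algebra_simps sum.distrib sum_distrib_left)
qed

lemma pd_add:
  assumes "hpoly k p" "hpoly l q"
  shows "pd i (\<lambda>x. p x + q x) x = pd i p x + pd i q x"
proof (rule pd_eqI[where g = "\<lambda>i. pd i p x + pd i q x"])
  show "((\<lambda>x. p x + q x) has_derivative (\<lambda>h. \<Sum>i\<in>UNIV. h $ i * (pd i p x + pd i q x))) (at x)"
    by (rule has_derivative_eq_rhs[OF has_derivative_add[OF has_derivative_hpoly[OF assms(1)] has_derivative_hpoly[OF assms(2)]]])
      (simp add: algebra_simps sum.distrib)
qed

lemma pd_scale:
  assumes "hpoly l q"
  shows "pd i (\<lambda>x. c * q x) x = c * pd i q x"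
  using pd_mult[OF hpoly.const[of c] assms, of i x] by (simp add: pd_hpoly_0 hpoly.const)

lemma pd_coordinate: "pd i (\<lambda>x. x $ j) x = (if i = j then 1 else 0)"
proof (rule pd_eqI[where g = "\<lambda>i. if i = j then 1 else 0"])
  have "(\<lambda>h::real^'a. \<Sum>i\<in>UNIV. h $ i * (if i = j then 1 else 0)) = (\<lambda>h. h $ j)"
    by (simp add: if_distrib[of "\<lambda>x. _ * x"] cong: if_cong)
  then show "((\<lambda>x. x $ j) has_derivative (\<lambda>h::real^'a. \<Sum>i\<in>UNIV. h $ i * (if i = j then 1 else 0))) (at x)"
    by (simp add: bounded_linear_imp_has_derivative bounded_linear_vec_nth)
qed

text \<open>The inner \<open>deriv\<close> in \<open>laplacian\<close> is taken at parameter
  \<open>t\<close> of a line through \<open>x\<close>; restarting that line at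
  \<open>x + t *\<^sub>R axis i 1\<close> turns it into \<open>pd\<close>.\<close>

lemma laplacian_eq_pd: "laplacian p x = (\<Sum>i\<in>UNIV. pd i (pd i p) x)" if "hpoly l p"
proof -
  have "deriv (\<lambda>s. p (x + s *\<^sub>R axis i 1)) t = pd i p (x + t *\<^sub>R axis i 1)" for i t
  proof -
    have "(\<lambda>s. p (x + s *\<^sub>R axis i 1)) = (\<lambda>u. p ((x + t *\<^sub>R axis i 1) + u *\<^sub>R axis i 1)) \<circ> (\<lambda>s. s - t)"
      by (auto simp: fun_eq_iff scaleR_left_diff_distrib)
    moreover have "((\<lambda>u. p ((x + t *\<^sub>R axis i 1) + u *\<^sub>R axis i 1)) has_real_derivative
        pd i p (x + t *\<^sub>R axis i 1)) (at (t - t))"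
      using has_real_derivative_along_axis[OF has_derivative_hpoly[OF that]] by simp
    moreover have "((\<lambda>s. s - t) has_real_derivative 1) (at t)"
      by (auto intro!: derivative_eq_intros)
    ultimately show ?thesis
      using DERIV_chain[of _ _ "\<lambda>s. s - t" t 1 UNIV] by (intro DERIV_imp_deriv) simp
  qed
  then show ?thesis
    by (simp add: laplacian_def pd_def[of _ "pd _ p"])
qed

section \<open>Integration by parts on the sphere\<close>

definition plane_rotation :: "'n::finite \<Rightarrow> 'n \<Rightarrow> real \<Rightarrow> real^'n \<Rightarrow> real^'n" where
  "plane_rotation i j t x = (\<chi> k. if k = i then cos t * x $ i - sin t * x $ j
     else if k = j then sin t * x $ i + cos t * x $ j else x $ k)"

lemma orthogonal_plane_rotation:
  fixes i j :: "'n::finite"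
  assumes "i \<noteq> j"
  shows "orthogonal_transformation (plane_rotation i j t)"
  unfolding orthogonal_transformation
proof (intro conjI allI)
  show "linear (plane_rotation i j t)"
    by (rule linearI) (auto simp: plane_rotation_def vec_eq_iff algebra_simps)
  fix x :: "real^'n"
  have split: "(\<Sum>k\<in>UNIV. f k) = f i + f j + (\<Sum>k\<in>UNIV - {i} - {j}. f k)" for f :: "'n \<Rightarrow> real"
    using assms by (simp add: sum.remove[of UNIV i] sum.remove[of "UNIV - {i}" j])
  have "(cos t * x $ i - sin t * x $ j)\<^sup>2 + (sin t * x $ i + cos t * x $ j)\<^sup>2 =
      ((sin t)\<^sup>2 + (cos t)\<^sup>2) * ((x $ i)\<^sup>2 + (x $ j)\<^sup>2)"
    by algebra
  then have rot: "(cos t * x $ i - sin t * x $ j)\<^sup>2 + (sin t * x $ i + cos t * x $ j)\<^sup>2 =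
      (x $ i)\<^sup>2 + (x $ j)\<^sup>2"
    by (simp only: sin_cos_squared_add mult_1)
  have "(\<Sum>k\<in>UNIV. (plane_rotation i j t x $ k)\<^sup>2) = (\<Sum>k\<in>UNIV. (x $ k)\<^sup>2)"
    unfolding split using assms rot by (simp add: plane_rotation_def)
  then show "norm (plane_rotation i j t x) = norm x"
    by (simp add: norm_vec_def L2_set_def)
qed

lemma hpoly_pd': "hpoly l p \<Longrightarrow> hpoly (l - 1) (pd i p)"
proof (cases l)
  case 0
  moreover assume "hpoly l p"
  ultimately have "pd i p = (\<lambda>x. 0)" by (auto simp: pd_hpoly_0)
  then show ?thesis by (simp add: hpoly_zero)
qed (simp add: hpoly_pd)

lemma continuous_on_pd: "hpoly l p \<Longrightarrow> continuous_on A (pd i p)"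
  by (rule continuous_on_hpoly[OF hpoly_pd'])

text \<open>The integrand is the derivative at angle 0 of \<open>f\<close> along the rotations of
  the \<open>(i, j)\<close>-plane, and the integral of the rotated \<open>f\<close> does not depend
  on the angle. Dominated convergence moves the derivative under the integral.\<close>

lemma integral_infinitesimal_rotation:
  fixes f :: "real^'n::finite \<Rightarrow> real"
  assumes f: "hpoly l f" and ij: "i \<noteq> j"
  shows "(LINT x|sphere_measure. x $ i * pd j f x - x $ j * pd i f x) = 0"
proof -
  define L where "L = (\<lambda>x. x $ i * pd j f x - x $ j * pd i f x)"
  let ?R = "plane_rotation i j"
  have cont_L: "continuous_on A L" for A
    unfolding L_def by (intro continuous_intros continuous_on_pd[OF f])
  have cont_f: "continuous_on A f" for A
    by (rule continuous_on_hpoly[OF f])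
  have cont_R: "continuous_on A (?R t)" for A t
    using orthogonal_plane_rotation[OF ij]
    by (intro linear_continuous_on) (simp add: orthogonal_transformation_linear linear_linear)
  have deriv: "((\<lambda>t. f (?R t x)) has_real_derivative L (?R t x)) (at t)" for x t
  proof -
    let ?y = "?R t x"
    let ?v = "\<chi> k. if k = i then - (?y $ j) else if k = j then ?y $ i else 0"
    have R: "((\<lambda>t. ?R t x) has_derivative (\<lambda>s. s *\<^sub>R ?v)) (at t)"
    proof (subst has_derivative_componentwise_within, rule ballI)
      fix b :: "real^'n" assume "b \<in> Basis"
      then obtain k where b: "b = axis k 1" by (auto simp: Basis_vec_def)
      have "((\<lambda>t. ?R t x $ k) has_derivative (\<lambda>s. s * ?v $ k)) (at t)"
        using ij unfolding plane_rotation_def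
        by (auto intro!: derivative_eq_intros simp: algebra_simps)
      then show "((\<lambda>t. ?R t x \<bullet> b) has_derivative (\<lambda>s. (s *\<^sub>R ?v) \<bullet> b)) (at t)"
        by (simp add: b inner_axis)
    qed
    have "((\<lambda>t. f (?R t x)) has_derivative (\<lambda>s. \<Sum>k\<in>UNIV. (s *\<^sub>R ?v) $ k * pd k f ?y)) (at t)"
      by (rule has_derivative_compose[OF R has_derivative_hpoly[OF f]])
    moreover have "(\<lambda>s. \<Sum>k\<in>UNIV. (s *\<^sub>R ?v) $ k * pd k f ?y) = (*) (L ?y)"
    proof -
      have "(\<Sum>k\<in>UNIV. (s *\<^sub>R ?v) $ k * pd k f ?y) =
        (\<Sum>k\<in>UNIV. (if k = i then - (s * (?y $ j * pd i f ?y)) else 0) + (if k = j then s * (?y $ i * pd j f ?y) else 0))" for s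
        using ij by (intro sum.cong) auto
      then have "(\<Sum>k\<in>UNIV. (s *\<^sub>R ?v) $ k * pd k f ?y) = L ?y * s" for s
        by (simp add: sum.distrib L_def algebra_simps)
      then show ?thesis by (rule ext)
    qed
    ultimately show ?thesis
      unfolding has_field_derivative_def by (simp only:)
  qed
  have "compact (L ` sphere 0 1)"
    by (intro compact_continuous_image cont_L) auto
  then obtain C where C: "\<And>x. norm x = 1 \<Longrightarrow> norm (L x) \<le> C"
    unfolding bounded_iff[symmetric] by (metis bounded_iff compact_imp_bounded image_eqI mem_sphere_0)
  \<comment> \<open>Angles \<open>h m\<close> tending to 0 through positive values, so that the
    convergence theorem for sequences applies to the difference quotients
    \<open>s m\<close>.\<close>
  define h where "h = (\<lambda>m. inverse (real (Suc m)))"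
  have h: "0 < h m" for m unfolding h_def by simp
  define s where "s = (\<lambda>m x. (f (?R (h m) x) - f x) / h m)"
  have R0: "?R 0 x = x" for x by (simp add: plane_rotation_def vec_eq_iff)
  have cont_s: "continuous_on A (s m)" for A m
    unfolding s_def
    using h[of m] by (intro continuous_intros cont_f continuous_on_compose2[OF cont_f cont_R]) auto
  have lim: "(\<lambda>m. s m x) \<longlonglongrightarrow> L x" for x
  proof -
    have "((\<lambda>t. (f (?R (0 + t) x) - f (?R 0 x)) / t) \<longlongrightarrow> L (?R 0 x)) (at 0)"
      using deriv[of x 0] unfolding DERIV_def .
    moreover have "filterlim h (at 0) sequentially"
      using LIMSEQ_inverse_real_of_nat unfolding filterlim_at h_def by simp
    ultimately show ?thesis
      unfolding s_def by (auto simp: R0 dest: filterlim_compose)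
  qed
  have bound: "norm (s m x) \<le> C" if x: "norm x = 1" for m x
  proof -
    \<comment> \<open>By the mean value theorem a difference quotient is a value of \<open>L\<close>
      at a rotated point, again on the sphere, where \<open>C\<close> bounds
      \<open>L\<close>.\<close>
    obtain z where "f (?R (h m) x) - f (?R 0 x) = (h m - 0) * L (?R z x)"
      using MVT2[OF h[of m], of "\<lambda>t. f (?R t x)" "\<lambda>t. L (?R t x)"] deriv by blast
    then have "s m x = L (?R z x)"
      using h[of m] by (simp add: s_def R0)
    moreover have "norm (?R z x) = 1"
      using orthogonal_transformation_norm[OF orthogonal_plane_rotation[OF ij]] x by simp
    ultimately show ?thesis using C by simp
  qed
  have "(\<lambda>m. LINT x|sphere_measure. s m x) \<longlonglongrightarrow> (LINT x|sphere_measure. L x)"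
  proof (rule integral_dominated_convergence[where w = "\<lambda>x. C"])
    show "AE x in sphere_measure. norm (s m x) \<le> C" for m
      using AE_in_sphere by eventually_elim (rule bound, simp)
  qed (auto intro!: lim integrable_sphere_measure borel_measurable_continuous_onI cont_L cont_s
      simp: measurable_cong_sets[OF sets_sphere_measure refl])
  moreover have "(LINT x|sphere_measure. s m x) = 0" for m
  proof -
    have i1: "integrable sphere_measure (\<lambda>x. f (?R (h m) x))"
      by (intro integrable_sphere_measure continuous_on_compose2[OF cont_f cont_R]) auto
    have i2: "integrable sphere_measure f"
      by (intro integrable_sphere_measure cont_f)
    show ?thesis
      unfolding s_def using integral_sphere_orthogonal[OF orthogonal_plane_rotation[OF ij] cont_f]
      by (simp add: Bochner_Integration.integral_diff[OF i1 i2])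
  qed
  ultimately show ?thesis
    unfolding L_def by (simp add: LIMSEQ_const_iff)
qed

text \<open>Integration by parts on the sphere, obtained by summing over \<open>i\<close> the rotation identity for
  \<open>x\<^sub>i G\<close> in the \<open>(i, j)\<close>-plane and applying Euler's identity.\<close>
lemma integral_sphere_pd:
  fixes G :: "real^'n::finite \<Rightarrow> real"
  assumes G: "hpoly m G"
  shows "(LINT x|sphere_measure. pd j G x) =
    (real CARD('n) + real m - 1) * (LINT x|sphere_measure. x $ j * G x)"
proof -
  let ?f = "\<lambda>i x. x $ i * G x"
  let ?L = "\<lambda>i x. x $ i * pd j (?f i) x - x $ j * pd i (?f i) x"
  have f: "hpoly (Suc m) (?f i)" for i
    using G by (rule hpoly.coord)
  have cont_L: "continuous_on A (?L i)" for i A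
    by (intro continuous_intros continuous_on_pd[OF f])
  have cont_G: "continuous_on A G" for A
    using G by (rule continuous_on_hpoly)
  have cont_pd: "continuous_on A (pd j G)" for A
    using G by (rule continuous_on_pd)
  have L0: "(LINT x|sphere_measure. ?L i x) = 0" for i
    by (cases "i = j") (use integral_infinitesimal_rotation[OF f] in auto)
  have pdf: "pd k (?f i) x = (if k = i then 1 else 0) * G x + x $ i * pd k G x" for k i x
    using pd_mult[OF hpoly_coordinate G] by (simp add: pd_coordinate)
  \<comment> \<open>The term \<open>i = j\<close> yields \<open>x $ j * G x\<close>, the relation
    \<open>x2\<close> collects \<open>pd j G x\<close>, differentiating \<open>x $ i\<close> in each
    summand yields \<open>CARD('n)\<close>, and Euler's identity yields the degree
    \<open>m\<close>.\<close>
  have sumL: "(\<Sum>i\<in>UNIV. ?L i x) = pd j G x - (real CARD('n) + real m - 1) * (x $ j * G x)"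
    if x: "norm x = 1" for x
  proof -
    have x2: "(\<Sum>i\<in>UNIV. x $ i * x $ i) = 1"
      using x by (simp add: norm_eq_1 inner_vec_def)
    have "(\<Sum>i\<in>UNIV. ?L i x) = (\<Sum>i\<in>UNIV. (if i = j then x $ j * G x else 0) +
        (x $ i * x $ i) * pd j G x - x $ j * G x - (x $ j) * (x $ i * pd i G x))"
      unfolding pdf by (intro sum.cong) (auto simp: algebra_simps)
    also have "\<dots> = x $ j * G x + pd j G x - real CARD('n) * (x $ j * G x) - x $ j * (real m * G x)"
      by (simp add: sum.distrib sum_subtractf sum_distrib_left[symmetric] sum_distrib_right[symmetric]
          x2 hpoly_euler[OF G])
    finally show ?thesis by (simp add: algebra_simps)
  qed
  have "0 = (\<Sum>i\<in>UNIV. LINT x|sphere_measure. ?L i x)"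
    by (simp add: L0)
  also have "\<dots> = (LINT x|sphere_measure. (\<Sum>i\<in>UNIV. ?L i x))"
    by (intro Bochner_Integration.integral_sum[symmetric] integrable_sphere_measure cont_L)
  also have "\<dots> = (LINT x|sphere_measure. pd j G x - (real CARD('n) + real m - 1) * (x $ j * G x))"
    by (intro integral_sphere_cong sumL continuous_on_sum cont_L continuous_intros cont_G cont_pd)
  also have "\<dots> = (LINT x|sphere_measure. pd j G x) -
      (LINT x|sphere_measure. (real CARD('n) + real m - 1) * (x $ j * G x))"
    by (intro Bochner_Integration.integral_diff integrable_sphere_measure continuous_intros cont_G cont_pd)
  finally show ?thesis by simp
qed

lemma pd_diff:
  assumes "hpoly k p" "hpoly l q"
  shows "pd i (\<lambda>x. p x - q x) x = pd i p x - pd i q x"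
  using pd_add[OF assms(1) hpoly_scale[OF assms(2), of "-1"]] pd_scale[OF assms(2), of i "-1"] by simp

text \<open>For \<open>k = 0\<close> the derivative is zero, and the zero function is homogeneous of
  every degree.\<close>

lemma hpoly_mult_pd:
  assumes "hpoly l h" "hpoly k p" "0 < k + l"
  shows "hpoly (k + l - 1) (\<lambda>x. h x * pd i p x)"
proof (cases k)
  case 0
  with assms(2) have "pd i p x = 0" for x by (simp add: pd_hpoly_0)
  then show ?thesis by (simp add: hpoly_zero)
next
  case (Suc m)
  then show ?thesis
    using hpoly_mult[OF assms(1) hpoly_pd[of m p i]] assms(2) by (simp add: add.commute)
qed

text \<open>Green's formula for the field \<open>G i = h * pd i p - p * pd i h\<close>. Its
  divergence is the integrand on the left, its radial component is \<open>(k - l) * h * p\<close> by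
  Euler's identity, and \<open>integral_sphere_pd\<close> in degree \<open>k + l - 1\<close> links
  the two.\<close>

lemma green_sphere:
  fixes h p :: "real^'n::finite \<Rightarrow> real"
  assumes h: "hpoly l h" and p: "hpoly k p" and kl: "0 < k + l"
  shows "(LINT x|sphere_measure. h x * (\<Sum>i\<in>UNIV. pd i (pd i p) x) - p x * (\<Sum>i\<in>UNIV. pd i (pd i h) x)) =
    (real CARD('n) + real k + real l - 2) * (real k - real l) * (LINT x|sphere_measure. h x * p x)"
proof -
  define G where "G = (\<lambda>i x. h x * pd i p x - p x * pd i h x)"
  have hp: "hpoly (k + l - 1) (\<lambda>x. h x * pd i p x)" "hpoly (k + l - 1) (\<lambda>x. p x * pd i h x)" for i
    using hpoly_mult_pd[OF h p kl, of i] hpoly_mult_pd[OF p h, of i] kl by (simp_all add: add.commute)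
  have G: "hpoly (k + l - 1) (G i)" for i
    unfolding G_def by (intro hpoly_diff hp)
  have pdG: "pd i (G i) x = h x * pd i (pd i p) x - p x * pd i (pd i h) x" for i x
    unfolding G_def pd_diff[OF hp] pd_mult[OF h hpoly_pd'[OF p]] pd_mult[OF p hpoly_pd'[OF h]]
    by simp
  have xG: "(\<Sum>i\<in>UNIV. x $ i * G i x) = (real k - real l) * (h x * p x)" for x
  proof -
    have "(\<Sum>i\<in>UNIV. x $ i * G i x) = h x * (\<Sum>i\<in>UNIV. x $ i * pd i p x) - p x * (\<Sum>i\<in>UNIV. x $ i * pd i h x)"
      unfolding sum_distrib_left sum_subtractf[symmetric] G_def by (intro sum.cong) (auto simp: algebra_simps)
    then show ?thesis by (simp add: hpoly_euler[OF h] hpoly_euler[OF p] algebra_simps)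
  qed
  have "(LINT x|sphere_measure. h x * (\<Sum>i\<in>UNIV. pd i (pd i p) x) - p x * (\<Sum>i\<in>UNIV. pd i (pd i h) x)) =
      (LINT x|sphere_measure. (\<Sum>i\<in>UNIV. pd i (G i) x))"
    unfolding pdG by (simp add: sum_subtractf sum_distrib_left)
  also have "\<dots> = (\<Sum>i\<in>UNIV. LINT x|sphere_measure. pd i (G i) x)"
    by (intro Bochner_Integration.integral_sum integrable_sphere_measure continuous_on_pd[OF G])
  also have "\<dots> = (\<Sum>i\<in>UNIV. (real CARD('n) + real k + real l - 2) * (LINT x|sphere_measure. x $ i * G i x))"
  proof (intro sum.cong refl)
    \<comment> \<open>Positivity of \<open>k + l\<close> keeps the natural number subtraction from
      being truncated.\<close>
    have "real CARD('n) + real (k + l - 1) - 1 = real CARD('n) + real k + real l - 2"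
      using kl by (cases "k + l") (auto simp flip: of_nat_add)
    then show "(LINT x|sphere_measure. pd i (G i) x) =
        (real CARD('n) + real k + real l - 2) * (LINT x|sphere_measure. x $ i * G i x)" for i
      using integral_sphere_pd[OF G, of i] by simp
  qed
  also have "\<dots> = (real CARD('n) + real k + real l - 2) * (LINT x|sphere_measure. (\<Sum>i\<in>UNIV. x $ i * G i x))"
    unfolding sum_distrib_left[symmetric]
    by (subst Bochner_Integration.integral_sum)
      (auto intro!: integrable_sphere_measure continuous_intros continuous_on_hpoly[OF G])
  finally show ?thesis by (simp add: xG)
qed

section \<open>Spherical harmonics and orthogonality to lower degrees\<close>

lemma sph_harm_iff: "h \<in> sph_harm l \<longleftrightarrow> hpoly l h \<and> (\<forall>x. (\<Sum>i\<in>UNIV. pd i (pd i h) x) = 0)"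
  unfolding sph_harm_def homog_poly_iff_hpoly by (auto simp: laplacian_eq_pd)

text \<open>Green's formula with harmonic \<open>h\<close> expresses the integral of
  \<open>h * p\<close>, up to a nonzero factor, by that of \<open>h\<close> times the Laplacian of
  \<open>p\<close>. The latter has degree \<open>k - 2\<close>, so strong induction applies.\<close>

lemma sph_harm_orthogonal_lower_degree:
  fixes h p :: "real^'n::finite \<Rightarrow> real"
  assumes n: "2 \<le> CARD('n)" and h: "h \<in> sph_harm l" and "hpoly k p" "k < l"
  shows "(LINT x|sphere_measure. h x * p x) = 0"
  using assms(3,4)
proof (induction k arbitrary: p rule: less_induct)
  case (less k)
  have hl: "hpoly l h" "\<And>x. (\<Sum>i\<in>UNIV. pd i (pd i h) x) = 0"
    using h by (auto simp: sph_harm_iff)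
  have "(LINT x|sphere_measure. h x * (\<Sum>i\<in>UNIV. pd i (pd i p) x)) = 0"
  proof (cases "2 \<le> k")
    case True
    have "hpoly (k - 1 - 1) (\<lambda>x. \<Sum>i\<in>UNIV. pd i (pd i p) x)"
      by (intro hpoly_sum hpoly_pd' less.prems)
    then show ?thesis using True less by (intro less.IH[of "k - 1 - 1"]) auto
  next
    case False
    \<comment> \<open>In degree at most 1 the first derivatives are constant, so the Laplacian
      vanishes.\<close>
    have "hpoly 0 (pd i p)" for i using hpoly_pd'[OF less.prems(1), of i] False by simp
    then show ?thesis by (simp add: pd_hpoly_0)
  qed
  then have "0 = (real CARD('n) + real k + real l - 2) * (real k - real l) * (LINT x|sphere_measure. h x * p x)"
    using green_sphere[OF hl(1) less.prems(1)] less.prems(2) by (simp add: hl(2))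
  moreover have "real CARD('n) + real k + real l - 2 \<noteq> 0" "real k - real l \<noteq> 0"
    using n less.prems(2) by auto
  ultimately show ?case by simp
qed

section \<open>Orthonormal systems and harmonic projections\<close>

text \<open>Real functions with pointwise operations as a vector space; this gives spans, linear
  independence and the exchange bound used to compare dimensions.\<close>

interpretation fv: vector_space "\<lambda>(c::real) (f::'a \<Rightarrow> real) x. c * f x"
  by standard (auto simp: fun_eq_iff algebra_simps)

lemma sum_function_apply: "(\<Sum>a\<in>A. f a) x = (\<Sum>a\<in>A. f a x)"
  by (induction A rule: infinite_finite_induct) auto

lemma fv_subspace_combination:
  assumes V: "fv.subspace V" and e: "\<And>i. i \<in> I \<Longrightarrow> e i \<in> V"
  shows "(\<lambda>x. \<Sum>i\<in>I. c i * e i x) \<in> V"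
proof -
  have "(\<Sum>i\<in>I. (\<lambda>x. c i * e i x)) \<in> V"
    by (rule fv.subspace_sum[OF V], rule fv.subspace_scale[OF V], rule e)
  moreover have "(\<lambda>x. \<Sum>i\<in>I. c i * e i x) = (\<Sum>i\<in>I. (\<lambda>x. c i * e i x))"
    by (simp add: fun_eq_iff sum_function_apply)
  ultimately show ?thesis by (simp only:)
qed

text \<open>Evaluating a linear relation at \<open>y k\<close> leaves only the coefficient of
  \<open>p k\<close>.\<close>

lemma fv_independent_evaluation:
  assumes "finite J" "\<And>j. j \<in> J \<Longrightarrow> p j (y j) \<noteq> 0"
    "\<And>j k. j \<in> J \<Longrightarrow> k \<in> J \<Longrightarrow> j \<noteq> k \<Longrightarrow> p j (y k) = 0"
  shows "inj_on p J \<and> fv.independent (p ` J)"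
proof
  show inj: "inj_on p J"
    by (rule inj_onI, rule ccontr) (metis assms(2,3))
  show "fv.independent (p ` J)"
  proof (rule fv.independent_if_scalars_zero)
    fix u v assume u: "(\<Sum>v\<in>p ` J. (\<lambda>x. u v * v x)) = 0" and "v \<in> p ` J"
    then obtain k where k: "k \<in> J" "v = p k" by auto
    have "0 = (\<Sum>v\<in>p ` J. (\<lambda>x. u v * v x)) (y k)" by (simp add: u)
    also have "\<dots> = (\<Sum>j\<in>J. u (p j) * p j (y k))"
      by (simp add: sum_function_apply sum.reindex[OF inj])
    also have "\<dots> = (\<Sum>j\<in>J. if j = k then u (p k) * p k (y k) else 0)"
      by (intro sum.cong) (use assms(3) k in auto)
    also have "\<dots> = u (p k) * p k (y k)" using assms(1) k by simp
    finally show "u v = 0" using assms(2) k by simp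
  qed (use assms(1) in simp)
qed

section \<open>The L2 inner product on the sphere and orthonormal systems\<close>

definition ip :: "(real^'n::finite \<Rightarrow> real) \<Rightarrow> (real^'n \<Rightarrow> real) \<Rightarrow> real" where
  "ip f g = (LINT x|sphere_measure. f x * g x)"

abbreviation "cont f \<equiv> continuous_on UNIV f"

lemma ip_commute: "ip f g = ip g f"
  by (simp add: ip_def mult.commute)

lemma ip_cong:
  fixes f g :: "real^'n::finite \<Rightarrow> real"
  assumes "cont f" "cont g" "cont h" "\<And>x. norm x = 1 \<Longrightarrow> f x = g x"
  shows "ip f h = ip g h"
  unfolding ip_def using assms by (intro integral_sphere_cong continuous_intros) auto

lemma ip_scale: "ip (\<lambda>x. c * f x) g = c * ip f g"
  by (simp add: ip_def mult.assoc)

lemma ip_diff: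
  assumes "cont f" "cont g" "cont h"
  shows "ip (\<lambda>x. f x - g x) h = ip f h - ip g h"
  unfolding ip_def left_diff_distrib using assms
  by (intro Bochner_Integration.integral_diff integrable_sphere_measure continuous_intros)

lemma ip_sum:
  assumes "\<And>i. i \<in> I \<Longrightarrow> cont (f i)" "cont h"
  shows "ip (\<lambda>x. \<Sum>i\<in>I. f i x) h = (\<Sum>i\<in>I. ip (f i) h)"
  unfolding ip_def sum_distrib_right using assms
  by (intro Bochner_Integration.integral_sum integrable_sphere_measure continuous_intros)

lemma ip_sum_scale:
  assumes "\<And>i. i \<in> I \<Longrightarrow> cont (f i)" "cont h"
  shows "ip (\<lambda>x. \<Sum>i\<in>I. c i * f i x) h = (\<Sum>i\<in>I. c i * ip (f i) h)"
  using assms by (subst ip_sum) (auto simp: ip_scale intro!: continuous_intros)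

lemma ip_self_nonneg: "0 \<le> ip f f"
  unfolding ip_def by (rule integral_nonneg_AE) simp

text \<open>If \<open>f x0\<close> were nonzero, then \<open>f\<close> would be nonzero on an open
  cone of directions around \<open>x0\<close>, which meets the ball in positive Lebesgue
  measure.\<close>

lemma ip_self_eq_0:
  fixes f :: "real^'n::finite \<Rightarrow> real"
  assumes f: "cont f" and "ip f f = 0" and x0: "norm x0 = 1"
  shows "f x0 = 0"
proof (rule ccontr)
  assume nz: "f x0 \<noteq> 0"
  have [measurable]: "f \<in> borel_measurable borel"
    using f by (rule borel_measurable_continuous_onI)
  have "AE x in sphere_measure. f x * f x = 0"
    using assms(2) unfolding ip_def
    by (subst (asm) integral_nonneg_eq_0_iff_AE)
      (auto intro!: integrable_sphere_measure continuous_intros f)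
  then have ae: "AE x in lborel. x \<in> cball 0 1 \<longrightarrow> f ((x::real^'n) /\<^sub>R norm x) * f (x /\<^sub>R norm x) = 0"
    by (subst (asm) AE_sphere_measure) auto
  let ?g = "\<lambda>x::real^'n. f (x /\<^sub>R norm x)"
  define U where "U = ?g -` (- {0}) \<inter> (ball 0 1 - {0})"
  have "continuous_on (ball 0 1 - {0}) ?g"
    by (intro continuous_on_compose2[OF f] continuous_intros) auto
  then have "open U"
    unfolding U_def by (intro continuous_on_open_vimage[THEN iffD1, rule_format]) auto
  moreover have "x0 /\<^sub>R 2 \<in> U"
    using x0 nz by (auto simp: U_def)
  moreover have "negligible U"
  proof -
    have "U \<in> null_sets lborel"
    proof (subst AE_iff_null_sets)
      show "U \<in> sets lborel" using \<open>open U\<close> by simp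
      show "AE x in lborel. x \<notin> U" using ae by (auto elim!: eventually_mono simp: U_def)
    qed
    then show ?thesis
      using negligible_iff_null_sets null_sets_completionI by blast
  qed
  ultimately show False using open_not_negligible by blast
qed

text \<open>Expand the square norm of \<open>f\<close> minus the sum of the \<open>g i\<close>. The
  family is orthogonal but not normalized, so harmonic projections, possibly zero, can be inserted
  directly.\<close>

lemma bessel:
  fixes f :: "real^'n::finite \<Rightarrow> real"
  assumes f: "cont f" and I: "finite I" and g: "\<And>i. i \<in> I \<Longrightarrow> cont (g i)"
    and orth: "\<And>i j. i \<in> I \<Longrightarrow> j \<in> I \<Longrightarrow> i \<noteq> j \<Longrightarrow> ip (g i) (g j) = 0"
    and proj: "\<And>i. i \<in> I \<Longrightarrow> ip f (g i) = ip (g i) (g i)"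
  shows "(\<Sum>i\<in>I. ip (g i) (g i)) \<le> ip f f"
proof -
  define s where "s = (\<lambda>x. \<Sum>i\<in>I. g i x)"
  have s: "cont s" unfolding s_def by (intro continuous_on_sum g)
  have fs: "cont (\<lambda>x. f x - s x)" by (intro continuous_intros f s)
  have sg: "ip s (g j) = ip (g j) (g j)" if "j \<in> I" for j
  proof -
    have "ip s (g j) = (\<Sum>i\<in>I. ip (g i) (g j))"
      unfolding s_def using g that by (intro ip_sum) auto
    also have "\<dots> = (\<Sum>i\<in>I. if i = j then ip (g j) (g j) else 0)"
      by (intro sum.cong) (use orth that in auto)
    finally show ?thesis using that I by simp
  qed
  have sum: "ip s h = (\<Sum>i\<in>I. ip h (g i))" if "cont h" for h
    unfolding s_def using g that by (subst ip_sum) (auto simp: ip_commute)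
  have "0 \<le> ip (\<lambda>x. f x - s x) (\<lambda>x. f x - s x)" by (rule ip_self_nonneg)
  also have "\<dots> = ip f (\<lambda>x. f x - s x) - ip s (\<lambda>x. f x - s x)"
    by (rule ip_diff[OF f s fs])
  also have "\<dots> = ip f f - ip s f - (ip s f - ip s s)"
    using ip_diff[OF f s f] ip_diff[OF f s s] by (simp add: ip_commute)
  also have "ip s f = (\<Sum>i\<in>I. ip (g i) (g i))" using sum[OF f] proj by simp
  also have "ip s s = (\<Sum>i\<in>I. ip (g i) (g i))" using sum[OF s] sg by simp
  finally show ?thesis by simp
qed

definition orthonormal :: "nat \<Rightarrow> (nat \<Rightarrow> real^'n::finite \<Rightarrow> real) \<Rightarrow> bool" where
  "orthonormal m e \<longleftrightarrow> (\<forall>i<m. cont (e i)) \<and>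
     (\<forall>i<m. \<forall>j<m. ip (e i) (e j) = (if i = j then 1 else 0))"

lemma orthonormalD:
  assumes "orthonormal m e"
  shows "i < m \<Longrightarrow> cont (e i)"
    "i < m \<Longrightarrow> j < m \<Longrightarrow> ip (e i) (e j) = (if i = j then 1 else 0)"
  using assms by (auto simp: orthonormal_def)

lemma orthonormal_bessel:
  assumes e: "orthonormal m e" and f: "cont f"
  shows "(\<Sum>i<m. (ip f (e i))\<^sup>2) \<le> ip f f"
proof -
  let ?g = "\<lambda>i x. ip f (e i) * e i x"
  have eq: "ip (?g i) (?g j) = ip f (e i) * ip f (e j) * ip (e i) (e j)" for i j
    using ip_scale[of "ip f (e i)" "e i"] ip_scale[of "ip f (e j)" "e j"] by (simp add: ip_commute)
  have "(\<Sum>i<m. ip (?g i) (?g i)) \<le> ip f f"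
  proof (rule bessel[OF f])
    show "cont (?g i)" if "i \<in> {..<m}" for i
      using orthonormalD(1)[OF e] that by (intro continuous_intros) auto
    show "ip f (?g i) = ip (?g i) (?g i)" if "i \<in> {..<m}" for i
      using orthonormalD(2)[OF e] that ip_scale[of "ip f (e i)" "e i" f]
      unfolding eq by (simp add: ip_commute)
  qed (auto simp: eq orthonormalD(2)[OF e])
  moreover have "(\<Sum>i<m. ip (?g i) (?g i)) = (\<Sum>i<m. (ip f (e i))\<^sup>2)"
    by (intro sum.cong) (auto simp: eq orthonormalD(2)[OF e] power2_eq_square)
  ultimately show ?thesis by simp
qed

text \<open>Pairing a linear relation with \<open>e k\<close> isolates one coefficient, so the
  system is independent and the exchange bound applies.\<close>

lemma orthonormal_le_card:
  assumes e: "orthonormal m e" and B: "finite B" and span: "\<And>i. i < m \<Longrightarrow> e i \<in> fv.span B"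
  shows "m \<le> card B"
proof -
  have inj: "inj_on e {..<m}"
  proof (rule inj_onI, rule ccontr)
    fix i j assume "i \<in> {..<m}" "j \<in> {..<m}" "e i = e j" "i \<noteq> j"
    then show False
      using orthonormalD(2)[OF e, of i i] orthonormalD(2)[OF e, of i j] by simp
  qed
  have "fv.independent (e ` {..<m})"
  proof (rule fv.independent_if_scalars_zero)
    fix u v assume u: "(\<Sum>v\<in>e ` {..<m}. (\<lambda>x. u v * v x)) = 0" and "v \<in> e ` {..<m}"
    then obtain k where k: "k < m" "v = e k" by auto
    have "(\<lambda>x. \<Sum>i<m. u (e i) * e i x) = (\<Sum>v\<in>e ` {..<m}. (\<lambda>x. u v * v x))"
      by (simp add: fun_eq_iff sum_function_apply sum.reindex[OF inj])
    then have "ip (\<lambda>x. \<Sum>i<m. u (e i) * e i x) (e k) = 0"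
      unfolding u by (simp add: ip_def)
    moreover have "ip (\<lambda>x. \<Sum>i<m. u (e i) * e i x) (e k) = (\<Sum>i<m. u (e i) * ip (e i) (e k))"
      using orthonormalD(1)[OF e] k by (intro ip_sum_scale) auto
    moreover have "\<dots> = (\<Sum>i<m. if i = k then u (e k) else 0)"
      using k by (intro sum.cong) (auto simp: orthonormalD(2)[OF e])
    ultimately show "u v = 0" using k by simp
  qed simp
  then have "card (e ` {..<m}) \<le> card B"
    using fv.independent_span_bound[OF B] span by blast
  then show ?thesis by (simp add: card_image[OF inj])
qed

text \<open>An orthonormal system of maximal length in \<open>V\<close>, which exists by the
  dimension bound, must be complete: a residual of nonzero norm could be normalized and appended.
  The expansion is claimed on the sphere only, because \<open>ip\<close> does not see other
  values.\<close>

lemma orthonormal_basis_exists: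
  fixes V :: "(real^'n::finite \<Rightarrow> real) set"
  assumes cont: "\<And>f. f \<in> V \<Longrightarrow> cont f" and V: "fv.subspace V"
    and B: "finite B" "V \<subseteq> fv.span B"
  shows "\<exists>m e. m \<le> card B \<and> orthonormal m e \<and> (\<forall>i<m. e i \<in> V) \<and>
    (\<forall>v\<in>V. \<forall>x. norm x = 1 \<longrightarrow> v x = (\<Sum>i<m. ip v (e i) * e i x))"
proof -
  define P where "P = (\<lambda>m. \<exists>e. orthonormal m e \<and> (\<forall>i<m. e i \<in> V))"
  have "P 0" by (simp add: P_def orthonormal_def)
  moreover have bound: "m \<le> card B" if "P m" for m
  proof -
    from that obtain e where "orthonormal m e" "\<forall>i<m. e i \<in> V" unfolding P_def by auto
    then show ?thesis using B(2) by (intro orthonormal_le_card[OF _ B(1)]) auto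
  qed
  ultimately obtain m where m: "P m" "\<forall>k. P k \<longrightarrow> k \<le> m"
    using ex_has_greatest_nat[of P 0 "\<lambda>m. m" "Suc (card B)"] by (auto simp: less_Suc_eq_le)
  then obtain e where e: "orthonormal m e" and eV: "\<And>i. i < m \<Longrightarrow> e i \<in> V"
    unfolding P_def by auto
  have "v x = (\<Sum>i<m. ip v (e i) * e i x)" if v: "v \<in> V" and x: "norm x = 1" for v x
  proof -
    define s where "s = (\<lambda>x. \<Sum>i<m. ip v (e i) * e i x)"
    define r where "r = (\<lambda>x. v x - s x)"
    have sV: "s \<in> V"
      unfolding s_def by (rule fv_subspace_combination[OF V]) (simp add: eV)
    then have rV: "r \<in> V"
      using fv.subspace_diff[OF V v sV] by (simp add: r_def fun_diff_def)
    have re: "ip r (e j) = 0" if j: "j < m" for j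
    proof -
      have "ip s (e j) = (\<Sum>i<m. ip v (e i) * ip (e i) (e j))"
        unfolding s_def using orthonormalD(1)[OF e] j by (intro ip_sum_scale) auto
      also have "\<dots> = (\<Sum>i<m. if i = j then ip v (e j) else 0)"
        using j by (intro sum.cong) (auto simp: orthonormalD(2)[OF e])
      finally have "ip s (e j) = ip v (e j)" using j by simp
      then show ?thesis
        unfolding r_def using cont v sV eV j by (simp add: ip_diff)
    qed
    have "ip r r = 0"
    proof (rule ccontr)
      assume "ip r r \<noteq> 0"
      then have pos: "0 < ip r r" using ip_self_nonneg[of r] by simp
      define c where "c = 1 / sqrt (ip r r)"
      have c: "c * (c * ip r r) = 1" using pos by (simp add: c_def field_simps)
      define e' where "e' = e(m := \<lambda>x. c * r x)"
      have e'V: "e' i \<in> V" if "i < Suc m" for i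
        using that eV fv.subspace_scale[OF V rV] by (auto simp: e'_def less_Suc_eq)
      have new1: "ip (\<lambda>x. c * r x) (e j) = 0" if "j < m" for j
        using re[OF that] by (simp add: ip_scale)
      have new2: "ip (e j) (\<lambda>x. c * r x) = 0" if "j < m" for j
        using new1[OF that] by (subst ip_commute)
      have "ip r (\<lambda>x. c * r x) = c * ip r r"
        by (subst ip_commute) (rule ip_scale)
      then have new3: "ip (\<lambda>x. c * r x) (\<lambda>x. c * r x) = 1"
        using c by (simp add: ip_scale)
      have "orthonormal (Suc m) e'"
        unfolding orthonormal_def
      proof (intro conjI allI impI)
        show "cont (e' i)" if "i < Suc m" for i using e'V[OF that] by (rule cont)
        show "ip (e' i) (e' j) = (if i = j then 1 else 0)" if "i < Suc m" "j < Suc m" for i j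
          using that new1 new2 new3 orthonormalD(2)[OF e]
          by (cases "i = m"; cases "j = m") (auto simp: e'_def)
      qed
      then have "P (Suc m)" using e'V unfolding P_def by (intro exI[of _ e'] conjI allI impI)
      then have "Suc m \<le> m" using m(2) by blast
      then show False by simp
    qed
    then have "r x = 0" using ip_self_eq_0[OF cont[OF rV] _ x] by simp
    then show ?thesis by (simp add: r_def s_def)
  qed
  then show ?thesis
    using e eV bound[OF m(1)] by (intro exI[of _ m] exI[of _ e]) simp
qed

section \<open>Finite-dimensional polynomial spaces and harmonic projections\<close>

lemma subspace_hpoly: "fv.subspace {p. hpoly l p}"
  unfolding fv.subspace_def
  by (auto simp: zero_fun_def plus_fun_def intro: hpoly_zero hpoly.add hpoly_scale)

lemma finite_hpoly_span:
  "\<exists>B. finite B \<and> {p::real^'n::finite \<Rightarrow> real. hpoly l p} \<subseteq> fv.span B"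
proof (intro exI conjI subsetI)
  let ?A = "{a::'n \<Rightarrow> nat. (\<Sum>i\<in>UNIV. a i) = l}"
  let ?m = "\<lambda>a (x::real^'n). \<Prod>i\<in>UNIV. (x $ i) ^ a i"
  have "a i \<le> l" if "a \<in> ?A" for a i
    using that member_le_sum[of i UNIV a] by auto
  then have "?A \<subseteq> PiE UNIV (\<lambda>_. {..l})" by auto
  then have "finite ?A" by (rule finite_subset) (intro finite_PiE, auto)
  then show "finite (?m ` ?A)" by (rule finite_imageI)
  fix p :: "real^'n \<Rightarrow> real" assume "p \<in> {p. hpoly l p}"
  then have "homog_poly l p" by (simp add: homog_poly_iff_hpoly)
  then obtain A c where A: "\<forall>a\<in>A. (\<Sum>i\<in>UNIV. a i) = l"
    and p: "p = (\<lambda>x. \<Sum>a\<in>A. c a * ?m a x)"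
    unfolding homog_poly_def by auto
  show "p \<in> fv.span (?m ` ?A)"
    unfolding p using A by (intro fv_subspace_combination fv.subspace_span fv.span_base) auto
qed

lemma subspace_sph_harm: "fv.subspace (sph_harm l)"
  unfolding fv.subspace_def
proof (intro conjI ballI allI)
  have "pd i (\<lambda>x. 0) = (\<lambda>x. 0)" for i :: 'a
    by (rule ext, rule pd_hpoly_0, rule hpoly_zero)
  then show "0 \<in> (sph_harm l :: (real^'a \<Rightarrow> real) set)"
    by (simp add: sph_harm_iff zero_fun_def hpoly_zero)
  fix p q :: "real^'a \<Rightarrow> real" and c
  assume p: "p \<in> sph_harm l"
  then have hp: "hpoly l p" by (simp add: sph_harm_iff)
  have "pd i (\<lambda>x. c * p x) = (\<lambda>x. c * pd i p x)" for i
    using pd_scale[OF hp] by (intro ext)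
  then have "(\<Sum>i\<in>UNIV. pd i (pd i (\<lambda>x. c * p x)) x) = c * (\<Sum>i\<in>UNIV. pd i (pd i p) x)" for x
    by (simp add: pd_scale[OF hpoly_pd'[OF hp]] sum_distrib_left)
  then show "(\<lambda>x. c * p x) \<in> sph_harm l"
    using p by (simp add: sph_harm_iff hpoly_scale)
  assume q: "q \<in> sph_harm l"
  then have hq: "hpoly l q" by (simp add: sph_harm_iff)
  have "pd i (\<lambda>x. p x + q x) = (\<lambda>x. pd i p x + pd i q x)" for i
    using pd_add[OF hp hq] by (intro ext)
  then have "(\<Sum>i\<in>UNIV. pd i (pd i (\<lambda>x. p x + q x)) x) =
      (\<Sum>i\<in>UNIV. pd i (pd i p) x) + (\<Sum>i\<in>UNIV. pd i (pd i q) x)" for x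
    by (simp add: pd_add[OF hpoly_pd'[OF hp] hpoly_pd'[OF hq]] sum.distrib)
  then show "p + q \<in> sph_harm l"
    using p q by (simp add: sph_harm_iff plus_fun_def hpoly.add)
qed

lemma cont_sph_harm: "h \<in> sph_harm l \<Longrightarrow> cont h"
  by (auto simp: sph_harm_iff intro: continuous_on_hpoly)

text \<open>This makes the definite description in \<open>harm_proj\<close> meaningful. Existence is
  the expansion in an orthonormal basis; the difference of two candidates is orthogonal to itself,
  hence zero on the sphere and, by homogeneity, everywhere.\<close>

lemma harm_proj_unique:
  fixes f :: "real^'n::finite \<Rightarrow> real"
  assumes f: "cont f"
  shows "\<exists>!g. g \<in> sph_harm l \<and> (\<forall>h\<in>sph_harm l. (LINT x|sphere_measure. (f x - g x) * h x) = 0)"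
proof -
  let ?V = "sph_harm l :: (real^'n \<Rightarrow> real) set"
  obtain B where B: "finite B" "{p::real^'n \<Rightarrow> real. hpoly l p} \<subseteq> fv.span B"
    using finite_hpoly_span by blast
  have "?V \<subseteq> fv.span B" using B(2) by (auto simp: sph_harm_iff)
  then have "\<exists>m e. m \<le> card B \<and> orthonormal m e \<and> (\<forall>i<m. e i \<in> ?V) \<and>
    (\<forall>v\<in>?V. \<forall>x. norm x = 1 \<longrightarrow> v x = (\<Sum>i<m. ip v (e i) * e i x))"
    by (intro orthonormal_basis_exists[OF _ subspace_sph_harm B(1)]) (rule cont_sph_harm)
  then obtain m e where "orthonormal m e \<and> (\<forall>i<m. e i \<in> ?V) \<and>
    (\<forall>v\<in>?V. \<forall>x. norm x = 1 \<longrightarrow> v x = (\<Sum>i<m. ip v (e i) * e i x))"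
    by blast
  then have e: "orthonormal m e" "\<And>i. i < m \<Longrightarrow> e i \<in> ?V"
    and rep: "\<And>v x. v \<in> ?V \<Longrightarrow> norm x = 1 \<Longrightarrow> v x = (\<Sum>i<m. ip v (e i) * e i x)"
    by auto
  have cont_e: "cont (e i)" if "i < m" for i using orthonormalD(1)[OF e(1) that] .
  define g where "g = (\<lambda>x. \<Sum>i<m. ip f (e i) * e i x)"
  have g: "g \<in> ?V"
    unfolding g_def by (rule fv_subspace_combination[OF subspace_sph_harm]) (simp add: e(2))
  have int: "(LINT x|sphere_measure. (f x - g x) * h x) = ip f h - ip g h" if "g \<in> ?V" "h \<in> ?V" for g h
    using ip_diff[OF f cont_sph_harm[OF that(1)] cont_sph_harm[OF that(2)]] by (simp add: ip_def)
  have fg: "ip f h = ip g h" if h: "h \<in> ?V" for h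
  proof -
    have "ip f h = ip h f" by (rule ip_commute)
    also have "\<dots> = ip (\<lambda>x. \<Sum>i<m. ip h (e i) * e i x) f"
    proof (rule ip_cong)
      show "cont (\<lambda>x. \<Sum>i<m. ip h (e i) * e i x)"
        by (intro continuous_intros) (simp add: cont_e)
    qed (use f cont_sph_harm[OF h] in \<open>simp_all add: rep[OF h, symmetric]\<close>)
    also have "\<dots> = (\<Sum>i<m. ip h (e i) * ip (e i) f)"
      using f cont_e by (intro ip_sum_scale) auto
    also have "\<dots> = (\<Sum>i<m. ip f (e i) * ip (e i) h)"
      by (simp add: ip_commute mult.commute)
    also have "\<dots> = ip g h"
      unfolding g_def using cont_e cont_sph_harm[OF h] by (intro ip_sum_scale[symmetric]) auto
    finally show ?thesis .
  qed
  show ?thesis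
  proof (intro ex1I[of _ g] conjI ballI g)
    fix h assume h: "h \<in> ?V"
    show "(LINT x|sphere_measure. (f x - g x) * h x) = 0"
      using int[OF g h] fg[OF h] by simp
  next
    fix g' assume g': "g' \<in> ?V \<and> (\<forall>h\<in>?V. (LINT x|sphere_measure. (f x - g' x) * h x) = 0)"
    let ?d = "\<lambda>x. g' x - g x"
    have d: "?d \<in> ?V"
      using fv.subspace_diff[OF subspace_sph_harm, of g' l g] g g' by (simp add: fun_diff_def)
    have "(LINT x|sphere_measure. (f x - g' x) * ?d x) = 0"
      using g' d by (rule conjunct2[THEN bspec])
    then have "ip g' ?d = ip g ?d"
      unfolding int[OF conjunct1[OF g'] d] fg[OF d] by (rule eq_iff_diff_eq_0[THEN iffD2, symmetric])
    then have "ip ?d ?d = 0"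
      using ip_diff[OF cont_sph_harm[OF conjunct1[OF g']] cont_sph_harm[OF g] cont_sph_harm[OF d]]
      by (simp only: diff_self)
    then have "g' x = g x" if "norm x = 1" for x
      using ip_self_eq_0[OF cont_sph_harm[OF d] _ that] by simp
    then show "g' = g"
      using g g' by (intro hpoly_eqI[of l]) (simp_all add: sph_harm_iff)
  qed
qed

lemma harm_proj:
  fixes f :: "real^'n::finite \<Rightarrow> real"
  assumes f: "cont f"
  shows "harm_proj l f \<in> sph_harm l"
    and "h \<in> sph_harm l \<Longrightarrow> ip (harm_proj l f) h = ip f h"
proof -
  let ?g = "harm_proj l f"
  have g: "?g \<in> sph_harm l \<and> (\<forall>h\<in>sph_harm l. (LINT x|sphere_measure. (f x - ?g x) * h x) = 0)"
    unfolding harm_proj_def by (rule theI'[OF harm_proj_unique[OF f]])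
  then show "?g \<in> sph_harm l" by simp
  show "ip ?g h = ip f h" if "h \<in> sph_harm l"
  proof -
    have "cont ?g" "cont h" using g that cont_sph_harm[of _ l] by auto
    then show ?thesis using ip_diff[OF f, of ?g h] g that by (simp add: ip_def)
  qed
qed

lemma L2sq_eq_ip: "L2sq f = ip f f"
  by (simp add: L2sq_def ip_def power2_eq_square)

lemma harm_proj_bessel:
  fixes f :: "real^'n::finite \<Rightarrow> real"
  assumes n: "2 \<le> CARD('n)" and f: "cont f"
  shows "(\<Sum>l\<le>L. L2sq (harm_proj l f)) \<le> L2sq f"
  unfolding L2sq_eq_ip
proof (rule bessel[OF f])
  show "ip (harm_proj i f) (harm_proj j f) = 0" if "i \<noteq> j" for i j
    using that
  proof (induction i j rule: linorder_wlog)
    case (le i j)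
    then show ?case
      using sph_harm_orthogonal_lower_degree[OF n harm_proj(1)[OF f, of j], of i "harm_proj i f"]
        harm_proj(1)[OF f, of i]
      by (simp add: sph_harm_iff ip_def mult.commute)
  qed (simp add: ip_commute)
  show "ip f (harm_proj i f) = ip (harm_proj i f) (harm_proj i f)" for i
    by (rule harm_proj(2)[OF f harm_proj(1)[OF f], symmetric])
  show "cont (harm_proj i f)" for i
    by (rule cont_sph_harm[OF harm_proj(1)[OF f]])
qed simp

text \<open>The square norm of the projection equals its inner product with \<open>f\<close>, whose
  degree is lower.\<close>

lemma L2sq_harm_proj_hpoly:
  fixes f :: "real^'n::finite \<Rightarrow> real"
  assumes n: "2 \<le> CARD('n)" and f: "hpoly k f" and "k < l"
  shows "L2sq (harm_proj l f) = 0"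
proof -
  have c: "cont f" using f by (rule continuous_on_hpoly)
  have "L2sq (harm_proj l f) = ip f (harm_proj l f)"
    using harm_proj[OF c] by (simp add: L2sq_eq_ip)
  then show ?thesis
    using sph_harm_orthogonal_lower_degree[OF n harm_proj(1)[OF c, of l] f \<open>k < l\<close>]
    by (simp add: ip_def mult.commute)
qed

section \<open>Polynomial fooling functions\<close>

text \<open>Homogenized Lagrange polynomials on the grid of integers from 0 to \<open>M\<close> in
  \<open>CARD('n) - 1\<close> coordinates. An arbitrary coordinate \<open>i0\<close> is the
  homogenizing variable, equal to 1 at the grid points \<open>y k\<close>; every other coordinate
  contributes \<open>M\<close> linear factors.\<close>

lemma lagrange_hpoly_independent:
  fixes M :: nat
  shows "\<exists>P. fv.independent P \<and> card P = Suc M ^ (CARD('n::finite) - 1) \<and>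
    P \<subseteq> {p :: real^'n \<Rightarrow> real. hpoly ((CARD('n) - 1) * M) p}"
proof -
  obtain i0 :: 'n where True by auto
  let ?U = "UNIV - {i0}"
  let ?J = "PiE ?U (\<lambda>_. {..M})"
  define p where "p = (\<lambda>k (x::real^'n). \<Prod>i\<in>?U. \<Prod>t\<in>{..M} - {k i}. x $ i - real t * x $ i0)"
  define y where "y = (\<lambda>k::'n \<Rightarrow> nat. \<chi> i. if i = i0 then 1 else real (k i))"
  have "inj_on p ?J \<and> fv.independent (p ` ?J)"
  proof (rule fv_independent_evaluation[where y = y])
    show "finite ?J" by (intro finite_PiE) auto
    fix j assume "j \<in> ?J"
    show "p j (y j) \<noteq> 0" by (simp add: p_def y_def)
    fix k assume "k \<in> ?J" and "j \<noteq> k"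
    with \<open>j \<in> ?J\<close> obtain i where "i \<in> ?U" "j i \<noteq> k i" by (meson PiE_ext)
    moreover have "k i \<le> M" using \<open>k \<in> ?J\<close> \<open>i \<in> ?U\<close> by auto
    \<comment> \<open>The factor of \<open>p j\<close> for coordinate \<open>i\<close> and
      \<open>t = k i\<close> is present because \<open>j i \<noteq> k i\<close>, and it vanishes at
      \<open>y k\<close>.\<close>
    ultimately show "p j (y k) = 0"
      unfolding p_def y_def by (auto intro!: bexI[of _ i] bexI[of _ "k i"])
  qed
  moreover have "card ?J = Suc M ^ (CARD('n) - 1)"
    by (simp add: card_PiE card_Diff_singleton)
  moreover have "hpoly ((CARD('n) - 1) * M) (p k)" if "k \<in> ?J" for k
  proof -
    have "hpoly (\<Sum>i\<in>?U. \<Sum>t\<in>{..M} - {k i}. 1) (p k)"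
      unfolding p_def One_nat_def
      by (intro hpoly_prod hpoly_diff hpoly_scale hpoly_coordinate) auto
    moreover have "(\<Sum>i\<in>?U. \<Sum>t\<in>{..M} - {k i}. 1) = (\<Sum>i\<in>?U. M)"
    proof (rule sum.cong[OF refl])
      fix i assume "i \<in> ?U"
      then have "k i \<in> {..M}" using that by auto
      then show "(\<Sum>t\<in>{..M} - {k i}. 1) = M" by (simp add: card_Diff_singleton)
    qed
    ultimately show ?thesis by (simp add: card_Diff_singleton)
  qed
  ultimately show ?thesis
    by (intro exI[of _ "p ` ?J"]) (auto simp: card_image)
qed

section \<open>The reproducing kernel of the homogeneous polynomials and its diagonal\<close>

definition kernel :: "nat \<Rightarrow> (nat \<Rightarrow> real^'n::finite \<Rightarrow> real) \<Rightarrow> real^'n \<Rightarrow> real^'n \<Rightarrow> real" where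
  "kernel D e y x = (\<Sum>i<D. e i y * e i x)"

definition hpoly_basis :: "nat \<Rightarrow> nat \<Rightarrow> (nat \<Rightarrow> real^'n::finite \<Rightarrow> real) \<Rightarrow> bool" where
  "hpoly_basis N D e \<longleftrightarrow> orthonormal D e \<and> (\<forall>i<D. hpoly N (e i)) \<and>
    (\<forall>p x. hpoly N p \<longrightarrow> p x = (\<Sum>i<D. ip p (e i) * e i x))"

lemma hpoly_basisD:
  assumes "hpoly_basis N D e"
  shows "orthonormal D e" "i < D \<Longrightarrow> hpoly N (e i)"
    "hpoly N p \<Longrightarrow> p x = (\<Sum>i<D. ip p (e i) * e i x)"
  using assms by (auto simp: hpoly_basis_def)

lemma hpoly_basis_exists:
  fixes N :: nat
  obtains D e where "hpoly_basis N D (e :: nat \<Rightarrow> real^'n::finite \<Rightarrow> real)"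
proof -
  let ?V = "{p::real^'n \<Rightarrow> real. hpoly N p}"
  obtain B where B: "finite B" "?V \<subseteq> fv.span B"
    using finite_hpoly_span by blast
  have "\<exists>m e. m \<le> card B \<and> orthonormal m e \<and> (\<forall>i<m. e i \<in> ?V) \<and>
    (\<forall>v\<in>?V. \<forall>x. norm x = 1 \<longrightarrow> v x = (\<Sum>i<m. ip v (e i) * e i x))"
    by (rule orthonormal_basis_exists[OF _ subspace_hpoly B]) (auto intro: continuous_on_hpoly)
  then obtain D e where "orthonormal D e \<and> (\<forall>i<D. e i \<in> ?V) \<and>
    (\<forall>v\<in>?V. \<forall>x. norm x = 1 \<longrightarrow> v x = (\<Sum>i<D. ip v (e i) * e i x))"
    by blast
  then have e: "orthonormal D e" "\<And>i. i < D \<Longrightarrow> hpoly N (e i)"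
    and rep: "\<And>v x. hpoly N v \<Longrightarrow> norm x = 1 \<Longrightarrow> v x = (\<Sum>i<D. ip v (e i) * e i x)"
    by auto
  \<comment> \<open>Both sides are homogeneous of degree \<open>N\<close>, so agreement on the
    sphere extends to the whole space.\<close>
  have "p = (\<lambda>x. \<Sum>i<D. ip p (e i) * e i x)" if "hpoly N p" for p
    using that by (rule hpoly_eqI) (auto intro!: hpoly_sum hpoly_scale e(2) rep[OF that])
  then have "hpoly_basis N D e"
    unfolding hpoly_basis_def using e by metis
  then show ?thesis by (rule that)
qed

text \<open>The basis spans the space, so \<open>D\<close> is at least the size of the independent
  Lagrange family; this is the growth of order \<open>N\<close> to the power
  \<open>d\<close>.\<close>

lemma hpoly_basis_card:
  fixes e :: "nat \<Rightarrow> real^'n::finite \<Rightarrow> real"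
  assumes e: "hpoly_basis ((CARD('n) - 1) * M) D e"
  shows "Suc M ^ (CARD('n) - 1) \<le> D"
proof -
  let ?N = "(CARD('n) - 1) * M"
  obtain P :: "(real^'n \<Rightarrow> real) set" where P: "fv.independent P" "card P = Suc M ^ (CARD('n) - 1)"
    "P \<subseteq> {p. hpoly ?N p}"
    using lagrange_hpoly_independent by blast
  have "p \<in> fv.span (e ` {..<D})" if "p \<in> P" for p
  proof -
    have "p = (\<lambda>x. \<Sum>i<D. ip p (e i) * e i x)"
      using that P(3) by (intro ext hpoly_basisD(3)[OF e]) auto
    also have "\<dots> \<in> fv.span (e ` {..<D})"
      by (intro fv_subspace_combination fv.subspace_span fv.span_base) auto
    finally show ?thesis .
  qed
  then have "card P \<le> card (e ` {..<D})"
    using fv.independent_span_bound[of "e ` {..<D}" P] P(1) by auto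
  also have "\<dots> \<le> D" using card_image_le[of "{..<D}" e] by simp
  finally show ?thesis by (simp add: P(2))
qed

lemma integral_sum_squares:
  assumes "orthonormal m u"
  shows "(LINT x|sphere_measure. (\<Sum>i<m. (u i x)\<^sup>2)) = real m"
proof -
  have "(LINT x|sphere_measure. (\<Sum>i<m. (u i x)\<^sup>2)) = (\<Sum>i<m. LINT x|sphere_measure. (u i x)\<^sup>2)"
    using orthonormalD(1)[OF assms]
    by (intro Bochner_Integration.integral_sum integrable_sphere_measure continuous_intros) auto
  also have "\<dots> = (\<Sum>i<m. ip (u i) (u i))" by (simp add: ip_def power2_eq_square)
  also have "\<dots> = real m" using orthonormalD(2)[OF assms] by simp
  finally show ?thesis .
qed

context
  fixes N D and e :: "nat \<Rightarrow> real^'n::finite \<Rightarrow> real"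
  assumes e: "hpoly_basis N D e"
begin

lemma hpoly_kernel: "hpoly N (kernel D e y)"
  unfolding kernel_def by (intro hpoly_sum hpoly_scale hpoly_basisD(2)[OF e]) simp

lemma cont_kernel: "cont (kernel D e y)"
  by (rule continuous_on_hpoly[OF hpoly_kernel])

lemma kernel_reproducing:
  assumes "hpoly N p"
  shows "ip p (kernel D e y) = p y"
proof -
  have "ip (kernel D e y) p = (\<Sum>i<D. e i y * ip (e i) p)"
    unfolding kernel_def using hpoly_basisD(2)[OF e] assms
    by (intro ip_sum_scale) (auto intro: continuous_on_hpoly)
  then show ?thesis
    using hpoly_basisD(3)[OF e assms, of y] by (simp add: ip_commute mult.commute)
qed

text \<open>Rotating the basis gives another orthonormal system of the same space, so Bessel's inequality
  for \<open>kernel D e y\<close> compares the diagonal at \<open>x = T y\<close> with the diagonal at \<open>y\<close>.\<close>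
lemma kernel_diagonal_le:
  assumes xy: "norm x = norm y"
  shows "kernel D e x x \<le> kernel D e y y"
proof -
  obtain T where T: "orthogonal_transformation T" "T y = x"
    using orthogonal_transformation_exists[of y x] xy by auto
  define f where "f = (\<lambda>i x. e i (T x))"
  have hf: "hpoly N (f i)" if "i < D" for i
    unfolding f_def using orthogonal_transformation_linear[OF T(1)] hpoly_basisD(2)[OF e that]
    by (rule hpoly_linear)
  have "orthonormal D f"
    unfolding orthonormal_def
  proof (intro conjI allI impI)
    show "cont (f i)" if "i < D" for i using hf[OF that] by (rule continuous_on_hpoly)
    fix i j assume ij: "i < D" "j < D"
    have "ip (f i) (f j) = ip (e i) (e j)"
      unfolding ip_def f_def using hpoly_basisD(2)[OF e] ij
      by (intro integral_sphere_orthogonal[OF T(1), of "\<lambda>x. e i x * e j x"] continuous_intros)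
        (auto intro: continuous_on_hpoly)
    then show "ip (f i) (f j) = (if i = j then 1 else 0)"
      using orthonormalD(2)[OF hpoly_basisD(1)[OF e] ij] by simp
  qed
  then have "(\<Sum>i<D. (ip (kernel D e y) (f i))\<^sup>2) \<le> ip (kernel D e y) (kernel D e y)"
    by (intro orthonormal_bessel cont_kernel)
  moreover have "ip (kernel D e y) (f i) = e i x" if "i < D" for i
    using kernel_reproducing[OF hf[OF that], of y] T(2) by (simp add: ip_commute f_def)
  ultimately show ?thesis
    using kernel_reproducing[OF hpoly_kernel, of y y] by (simp add: kernel_def power2_eq_square)
qed

text \<open>The comparison \<open>kernel_diagonal_le\<close> in both directions makes the diagonal
  constant on the sphere, and its integral is the number \<open>D\<close> of basis
  functions.\<close>

lemma kernel_diagonal: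
  assumes y: "norm y = 1"
  shows "kernel D e y y = real D"
proof -
  have eq: "kernel D e x x = kernel D e y y" if "norm x = 1" for x
    using that y by (intro antisym kernel_diagonal_le) auto
  have "real D = (LINT x|sphere_measure. (\<Sum>i<D. (e i x)\<^sup>2))"
    using integral_sum_squares[OF hpoly_basisD(1)[OF e]] by simp
  also have "\<dots> = (LINT x|(sphere_measure :: (real^'n) measure). kernel D e y y)"
    using orthonormalD(1)[OF hpoly_basisD(1)[OF e]]
    by (intro integral_sphere_cong continuous_intros)
      (auto simp: eq[symmetric], simp add: kernel_def power2_eq_square)
  finally show ?thesis by (simp only: integral_sphere_const)
qed

text \<open>Take the diagonal of the kernel of the orthogonal complement of \<open>span {kernel D e (x j)}\<close>:
  that complement consists of the polynomials vanishing at the nodes.\<close>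
lemma fooling_polynomial:
  fixes x :: "nat \<Rightarrow> real^'n"
  assumes x: "\<And>j. j < n \<Longrightarrow> norm (x j) = 1"
  shows "\<exists>q. hpoly (2 * N) q \<and> (\<forall>y. norm y = 1 \<longrightarrow> 0 \<le> q y \<and> q y \<le> real D) \<and>
    (\<forall>j<n. q (x j) = 0) \<and> real D - real n \<le> (LINT y|sphere_measure. q y)"
proof -
  let ?B = "(\<lambda>j. kernel D e (x j)) ` {..<n}"
  let ?W = "fv.span ?B"
  have WV: "?W \<subseteq> {p. hpoly N p}"
    by (intro fv.span_minimal subspace_hpoly) (auto intro: hpoly_kernel)
  have "\<exists>m u. m \<le> card ?B \<and> orthonormal m u \<and> (\<forall>i<m. u i \<in> ?W) \<and>
    (\<forall>v\<in>?W. \<forall>y. norm y = 1 \<longrightarrow> v y = (\<Sum>i<m. ip v (u i) * u i y))"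
    using WV by (intro orthonormal_basis_exists fv.subspace_span) (auto intro: continuous_on_hpoly)
  then obtain m u where m: "m \<le> card ?B" and u: "orthonormal m u" "\<And>i. i < m \<Longrightarrow> u i \<in> ?W"
    and rep: "\<And>v y. v \<in> ?W \<Longrightarrow> norm y = 1 \<Longrightarrow> v y = (\<Sum>i<m. ip v (u i) * u i y)"
    by auto
  have mn: "m \<le> n" using m card_image_le[of "{..<n}" "\<lambda>j. kernel D e (x j)"] by simp
  have hu: "hpoly N (u i)" if "i < m" for i using u(2)[OF that] WV by auto
  have ku: "ip (kernel D e y) (u i) = u i y" if "i < m" for i y
    using kernel_reproducing[OF hu[OF that], of y] by (simp add: ip_commute)
  define q where "q = (\<lambda>y. (\<Sum>i<D. (e i y)\<^sup>2) - (\<Sum>i<m. (u i y)\<^sup>2))"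
  have kd: "(\<Sum>i<D. (e i y)\<^sup>2) = kernel D e y y" for y
    by (simp add: kernel_def power2_eq_square)
  have "hpoly (2 * N) q"
    unfolding q_def by (intro hpoly_diff hpoly_sum hpoly_power hpoly_basisD(2)[OF e] hu) auto
  moreover have "0 \<le> q y \<and> q y \<le> real D" if y: "norm y = 1" for y
  proof
    \<comment> \<open>The subtracted sum consists of the squared coefficients of
      \<open>kernel D e y\<close> in the system \<open>u\<close>, so Bessel's inequality bounds it
      by the diagonal.\<close>
    have "(\<Sum>i<m. (u i y)\<^sup>2) = (\<Sum>i<m. (ip (kernel D e y) (u i))\<^sup>2)"
      by (simp add: ku)
    also have "\<dots> \<le> ip (kernel D e y) (kernel D e y)"
      by (intro orthonormal_bessel u(1) cont_kernel)
    also have "\<dots> = kernel D e y y"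
      by (rule kernel_reproducing[OF hpoly_kernel])
    finally show "0 \<le> q y" by (simp add: q_def kd)
    show "q y \<le> real D"
      by (simp add: q_def kd kernel_diagonal[OF y] sum_nonneg)
  qed
  moreover have "q (x j) = 0" if j: "j < n" for j
  proof -
    \<comment> \<open>At a node the kernel function itself lies in \<open>?W\<close>, so its
      expansion in \<open>u\<close> is exact and the subtracted sum exhausts the diagonal.\<close>
    have "kernel D e (x j) (x j) = (\<Sum>i<m. ip (kernel D e (x j)) (u i) * u i (x j))"
      using j by (intro rep fv.span_base x) auto
    also have "\<dots> = (\<Sum>i<m. (u i (x j))\<^sup>2)"
      by (simp add: ku power2_eq_square)
    finally show ?thesis by (simp add: q_def kd)
  qed
  moreover have "(LINT y|sphere_measure. q y) = real D - real m"
    unfolding q_def integral_sum_squares[OF u(1), symmetric]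
      integral_sum_squares[OF hpoly_basisD(1)[OF e], symmetric]
    using orthonormalD(1)[OF u(1)] orthonormalD(1)[OF hpoly_basisD(1)[OF e]]
    by (intro Bochner_Integration.integral_diff integrable_sphere_measure continuous_intros) auto
  ultimately show ?thesis using mn by (intro exI[of _ q]) auto
qed

end

section \<open>Growth of the weights\<close>

lemma ln_ge_one: "1 \<le> ln x" if "3 \<le> x" for x :: real
  using that exp_le by (subst ln_ge_iff) auto

text \<open>For negative \<open>b\<close> the function need not be increasing on the whole range,
  but it is up to a constant, because the logarithm grows more slowly than any positive
  power.\<close>

lemma powr_ln_almost_mono:
  fixes a b :: real
  assumes a: "0 < a"
  shows "\<exists>K>0. \<forall>y Y. 3 \<le> y \<longrightarrow> y \<le> Y \<longrightarrow>
    y powr a * ln y powr b \<le> K * (Y powr a * ln Y powr b)"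
proof (cases "0 \<le> b")
  case True
  have "y powr a * ln y powr b \<le> 1 * (Y powr a * ln Y powr b)" if "3 \<le> y" "y \<le> Y" for y Y :: real
    using that a True ln_ge_one[of y] by (simp add: mult_mono powr_mono2)
  then show ?thesis by (intro exI[of _ 1]) simp
next
  case False
  define g where "g = - b"
  have g: "0 < g" using False by (simp add: g_def)
  \<comment> \<open>With this exponent, raising \<open>(Y / y) powr t\<close> to the power
    \<open>g\<close> gives exactly \<open>(Y / y) powr a\<close>.\<close>
  define t where "t = a / g"
  have t: "0 < t" using a g by (simp add: t_def)
  define K where "K = (1 + 1 / t) powr g"
  have K: "0 < K" unfolding K_def using t by (simp add: add_pos_pos less_imp_neq[symmetric])
  have "y powr a * ln y powr b \<le> K * (Y powr a * ln Y powr b)" if y: "3 \<le> y" "y \<le> Y" for y Y :: real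
  proof -
    have ly: "1 \<le> ln y" and lY: "1 \<le> ln Y" using y ln_ge_one by auto
    have q: "1 \<le> Y / y" using y by simp
    then have q1: "1 \<le> (Y / y) powr t" using t by (intro ge_one_powr_ge_zero) auto
    have "ln Y = ln y + ln (Y / y)" using y by (simp add: ln_div)
    also have "\<dots> \<le> ln y + (Y / y) powr t / t" using ln_powr_bound[OF q t] by simp
    also have "\<dots> \<le> ln y * (Y / y) powr t + ln y * ((Y / y) powr t / t)"
    proof (rule add_mono)
      show "ln y \<le> ln y * (Y / y) powr t" using q1 ly by simp
      show "(Y / y) powr t / t \<le> ln y * ((Y / y) powr t / t)"
        using mult_right_mono[OF ly, of "(Y / y) powr t / t"] t by simp
    qed
    also have "\<dots> = (1 + 1 / t) * (Y / y) powr t * ln y" by (simp add: algebra_simps)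
    finally have "ln Y powr g \<le> ((1 + 1 / t) * (Y / y) powr t * ln y) powr g"
      using lY g by (intro powr_mono2) auto
    also have "\<dots> = K * (Y / y) powr a * ln y powr g"
      using g t ly by (simp add: powr_mult powr_powr K_def t_def)
    also have "(Y / y) powr a = Y powr a / y powr a" using y by (simp add: powr_divide)
    finally have le: "ln Y powr g \<le> K * (Y powr a / y powr a) * ln y powr g" .
    have arith: "A / p \<le> K * (B / q)" if "q \<le> K * (B / A) * p" "0 < A" "0 < p" "0 < q" for A B p q :: real
      using that by (simp add: field_simps)
    have "y powr a / ln y powr g \<le> K * (Y powr a / ln Y powr g)"
      by (rule arith[OF le]) (use y ly lY in auto)
    moreover have "z powr b = 1 / z powr g" for z :: real
      by (simp add: g_def powr_minus_divide)
    ultimately show ?thesis by simp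
  qed
  then show ?thesis using K by blast
qed

lemma powr_ln_bound:
  fixes a b d C :: real
  assumes a: "0 < a" and d: "0 < d" and C: "3 \<le> C"
  shows "\<exists>K>0. \<forall>(n::nat) y. 2 \<le> n \<longrightarrow> 3 \<le> y \<longrightarrow> y \<le> C * real n powr (2 / d) \<longrightarrow>
    y powr a * ln y powr b \<le> K * (real n powr (2 * a / d) * ln (real n) powr b)"
proof -
  obtain K where K: "0 < K" "\<And>y Y. 3 \<le> y \<Longrightarrow> y \<le> Y \<Longrightarrow>
    y powr a * ln y powr b \<le> K * (Y powr a * ln Y powr b)"
    using powr_ln_almost_mono[OF a, of b] by blast
  define c1 where "c1 = 2 / d"
  \<comment> \<open>The logarithm of \<open>C * n powr (2 / d)\<close> lies between
    \<open>c1 * ln n\<close> and \<open>c2 * ln n\<close>; as \<open>n \<ge> 2\<close>, the summand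
    \<open>ln C\<close> is absorbed through the quotient \<open>ln C / ln 2\<close>.\<close>
  define c2 where "c2 = ln C / ln 2 + 2 / d"
  have lnC: "1 \<le> ln C" using C by (rule ln_ge_one)
  have c: "0 < c1" "0 < c2" using d lnC by (auto simp: c1_def c2_def intro!: add_pos_pos)
  \<comment> \<open>The sum of both powers covers the two signs of \<open>b\<close>: the upper bound
    \<open>c2\<close> serves for \<open>b \<ge> 0\<close>, the lower bound \<open>c1\<close> for
    \<open>b < 0\<close>.\<close>
  define A where "A = C powr a * (c1 powr b + c2 powr b)"
  have A: "0 < A" using C c by (simp add: A_def add_pos_pos)
  have "y powr a * ln y powr b \<le> K * A * (real n powr (2 * a / d) * ln (real n) powr b)"
    if n: "2 \<le> n" and y: "3 \<le> y" "y \<le> C * real n powr (2 / d)" for n :: nat and y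
  proof -
    let ?Y = "C * real n powr (2 / d)"
    have ln2: "ln 2 \<le> ln (real n)" "0 < ln (real n)" using n by auto
    have lnY: "ln ?Y = ln C + c1 * ln (real n)"
      using C n by (simp add: ln_mult ln_powr c1_def)
    have lo: "c1 * ln (real n) \<le> ln ?Y" using lnC by (simp add: lnY)
    have "ln C = ln C / ln 2 * ln 2" by simp
    also have "\<dots> \<le> ln C / ln 2 * ln (real n)"
      using lnC ln2 by (intro mult_left_mono) auto
    finally have hi: "ln ?Y \<le> c2 * ln (real n)"
      unfolding lnY c1_def c2_def by (simp add: algebra_simps)
    have "ln ?Y powr b \<le> (c1 powr b + c2 powr b) * ln (real n) powr b"
    proof (cases "0 \<le> b")
      case True
      have "0 < c1 * ln (real n)" using c ln2 by simp
      then have "ln ?Y powr b \<le> (c2 * ln (real n)) powr b"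
        using True hi lo by (intro powr_mono2) auto
      also have "\<dots> \<le> (c1 powr b + c2 powr b) * ln (real n) powr b"
        using c ln2 by (simp add: powr_mult mult_right_mono)
      finally show ?thesis .
    next
      case False
      have "0 < c1 * ln (real n)" using c ln2 by simp
      then have "ln ?Y powr b \<le> (c1 * ln (real n)) powr b"
        using False lo by (intro powr_mono2') auto
      also have "\<dots> \<le> (c1 powr b + c2 powr b) * ln (real n) powr b"
        using c ln2 by (simp add: powr_mult mult_right_mono)
      finally show ?thesis .
    qed
    moreover have "?Y powr a = C powr a * real n powr (2 * a / d)"
      using C by (simp add: powr_mult powr_powr)
    ultimately have "?Y powr a * ln ?Y powr b \<le> A * (real n powr (2 * a / d) * ln (real n) powr b)"
      using mult_left_mono[of "ln ?Y powr b" "(c1 powr b + c2 powr b) * ln (real n) powr b"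
          "C powr a * real n powr (2 * a / d)"]
      by (simp add: A_def mult_ac)
    then have "K * (?Y powr a * ln ?Y powr b) \<le> K * (A * (real n powr (2 * a / d) * ln (real n) powr b))"
      using K(1) by (intro mult_left_mono) auto
    then show ?thesis using K(2)[OF y] by (simp add: mult.assoc)
  qed
  then show ?thesis using K(1) A by (intro exI[of _ "K * A"]) auto
qed

lemma lam_pos: "0 < lam TYPE('n::finite) \<alpha> \<beta> l" if "2 \<le> CARD('n)"
proof -
  have "0 \<le> real l * (real l + real (sph_dim TYPE('n)) - 1)"
    using that by (simp add: sph_dim_def)
  then show ?thesis by (simp add: lam_def Let_def)
qed

lemma inverse_lam_bound:
  fixes \<alpha> \<beta> :: real
  assumes n: "2 \<le> CARD('n::finite)" and \<alpha>: "0 < \<alpha>"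
  defines "d \<equiv> CARD('n) - 1"
  shows "\<exists>K>0. \<forall>n\<ge>2. \<forall>l. real l \<le> 6 * real d * real n powr (1 / real d) \<longrightarrow>
    1 / lam TYPE('n) \<alpha> \<beta> l \<le> K * (real n powr (\<alpha> / real d) * ln (real n) powr \<beta>)"
proof -
  have d: "1 \<le> real d" using n by (simp add: d_def)
  then have d0: "0 < real d" by linarith
  have \<alpha>2: "0 < \<alpha> / 2" using \<alpha> by simp
  \<comment> \<open>With \<open>r = n powr (1 / d) \<ge> 1\<close>, the eigenvalue \<open>m\<close>
    is at most \<open>6 d r * 7 d r\<close>, whence
    \<open>3 + m \<le> C * r\<^sup>2\<close>.\<close>
  define C where "C = 3 + 42 * (real d)\<^sup>2"
  have C3: "3 \<le> C" by (simp add: C_def)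
  obtain K where K: "0 < K" "\<And>(n::nat) y. 2 \<le> n \<Longrightarrow> 3 \<le> y \<Longrightarrow> y \<le> C * real n powr (2 / real d) \<Longrightarrow>
    y powr (\<alpha> / 2) * ln y powr \<beta> \<le> K * (real n powr (2 * (\<alpha> / 2) / real d) * ln (real n) powr \<beta>)"
    using powr_ln_bound[OF \<alpha>2 d0 C3, of \<beta>] by blast
  have "1 / lam TYPE('n) \<alpha> \<beta> l \<le> K * (real n powr (\<alpha> / real d) * ln (real n) powr \<beta>)"
    if n2: "2 \<le> n" and l: "real l \<le> 6 * real d * real n powr (1 / real d)" for n l :: nat
  proof -
    define r where "r = real n powr (1 / real d)"
    have r: "1 \<le> r" unfolding r_def using n2 d by (intro ge_one_powr_ge_zero) auto
    define m where "m = real l * (real l + real d - 1)"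
    have m: "0 \<le> m" using d by (simp add: m_def)
    have "real l + real d - 1 \<le> 6 * real d * r + real d * r"
    proof -
      have "real d * 1 \<le> real d * r" by (rule mult_left_mono[OF r]) simp
      then show ?thesis using l unfolding r_def by linarith
    qed
    then have "m \<le> (6 * real d * r) * (6 * real d * r + real d * r)"
      unfolding m_def using l d unfolding r_def[symmetric] by (intro mult_mono) auto
    moreover have "1 \<le> r\<^sup>2" using r by (simp add: one_le_power)
    moreover have "(6 * real d * r) * (6 * real d * r + real d * r) = 42 * ((real d)\<^sup>2 * r\<^sup>2)"
      by (simp add: power2_eq_square)
    moreover have "C * r\<^sup>2 = 3 * r\<^sup>2 + 42 * ((real d)\<^sup>2 * r\<^sup>2)"
      by (simp add: C_def distrib_right)
    ultimately have "3 + m \<le> C * r\<^sup>2" by linarith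
    moreover have "r\<^sup>2 = real n powr (2 / real d)"
      using n2 by (simp add: r_def powr_power)
    ultimately have "(3 + m) powr (\<alpha> / 2) * ln (3 + m) powr \<beta> \<le>
        K * (real n powr (\<alpha> / real d) * ln (real n) powr \<beta>)"
      using K(2)[OF n2, of "3 + m"] m by simp
    moreover have "(1 + m) powr (\<alpha> / 2) * ln (3 + m) powr \<beta> \<le> (3 + m) powr (\<alpha> / 2) * ln (3 + m) powr \<beta>"
      using m \<alpha> by (intro mult_right_mono powr_mono2) auto
    moreover have "1 / lam TYPE('n) \<alpha> \<beta> l = (1 + m) powr (\<alpha> / 2) * ln (3 + m) powr \<beta>"
    proof -
      have "lam TYPE('n) \<alpha> \<beta> l = (1 + m) powr (- (\<alpha> / 2)) * ln (3 + m) powr (- \<beta>)"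
        by (simp add: lam_def Let_def sph_dim_def m_def d_def)
      then show ?thesis by (simp add: powr_minus inverse_eq_divide)
    qed
    ultimately show ?thesis by linarith
  qed
  then show ?thesis using K(1) by blast
qed

text \<open>Components of degree above \<open>L\<close> vanish. On the remaining ones the weights
  are at most \<open>s\<^sup>2\<close>, so Bessel's inequality bounds the squared norm by
  \<open>s\<^sup>2\<close> times that of \<open>f\<close> in L2.\<close>

lemma hpoly_in_H_unit_ball:
  fixes f :: "real^'n::finite \<Rightarrow> real"
  assumes n: "2 \<le> CARD('n)" and f: "hpoly L f" and s: "0 < s"
    and lam: "\<And>l. l \<le> L \<Longrightarrow> 1 / lam TYPE('n) \<alpha> \<beta> l \<le> s"
    and bound: "\<And>x. norm x = 1 \<Longrightarrow> \<bar>f x\<bar> \<le> 1 / s"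
  shows "f \<in> H_unit_ball TYPE('n) \<alpha> \<beta>"
proof -
  have c: "cont f" using f by (rule continuous_on_hpoly)
  let ?a = "\<lambda>l. (lam TYPE('n) \<alpha> \<beta> l)\<^sup>2 powr (-1) * L2sq (harm_proj l f)"
  have zero: "?a l = 0" if "l \<notin> {..L}" for l
    using L2sq_harm_proj_hpoly[OF n f, of l] that by simp
  have "(\<Sum>l\<le>L. ?a l) \<le> (\<Sum>l\<le>L. s\<^sup>2 * L2sq (harm_proj l f))"
  proof (intro sum_mono mult_right_mono)
    fix l assume "l \<in> {..L}"
    then have "(1 / lam TYPE('n) \<alpha> \<beta> l)\<^sup>2 \<le> s\<^sup>2"
      using lam[of l] lam_pos[OF n, of \<alpha> \<beta> l] by (intro power_mono) auto
    then show "(lam TYPE('n) \<alpha> \<beta> l)\<^sup>2 powr (-1) \<le> s\<^sup>2"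
      using lam_pos[OF n, of \<alpha> \<beta> l] by (simp add: powr_minus power_divide inverse_eq_divide)
  qed (simp add: L2sq_eq_ip ip_self_nonneg)
  also have "\<dots> \<le> s\<^sup>2 * L2sq f"
    unfolding sum_distrib_left[symmetric] by (intro mult_left_mono harm_proj_bessel[OF n c]) simp
  also have "\<dots> \<le> s\<^sup>2 * (1 / s)\<^sup>2"
  proof (intro mult_left_mono)
    have "L2sq f \<le> (LINT x|(sphere_measure :: (real^'n) measure). (1 / s)\<^sup>2)"
      unfolding L2sq_def
    proof (intro integral_sphere_mono continuous_intros c)
      show "(f x)\<^sup>2 \<le> (1 / s)\<^sup>2" if "norm x = 1" for x
        using power_mono[OF bound[OF that], of 2] by simp
    qed
    then show "L2sq f \<le> (1 / s)\<^sup>2" by (simp only: integral_sphere_const)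
  qed simp
  also have "\<dots> = 1" using s by (simp add: power_divide)
  finally have "(\<Sum>l\<le>L. ?a l) \<le> 1" .
  then show ?thesis
    unfolding H_unit_ball_def using c zero
    using summable_finite[of "{..L}" ?a] suminf_finite[of "{..L}" ?a] by simp
qed

section \<open>The lower bound\<close>

theorem theorem1p2:
  fixes \<alpha> \<beta> :: real
  assumes "CARD('n::finite) \<ge> 3"
    and "\<alpha> > real (sph_dim TYPE('n)) / 2"
  shows "\<exists>c>0. \<forall>n::nat. n \<ge> 2 \<longrightarrow>
    ereal (c * real n powr (-\<alpha> / real (sph_dim TYPE('n))) * (ln (real n)) powr (-\<beta>))
      \<le> quad_error TYPE('n) \<alpha> \<beta> n"
proof -
  define d where "d = CARD('n) - 1"
  have d: "1 \<le> real d" "sph_dim TYPE('n) = d" "2 \<le> CARD('n)"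
    using assms(1) by (auto simp: d_def sph_dim_def)
  have \<alpha>: "0 < \<alpha>" using assms(2) d by simp
  obtain K where K: "0 < K" "\<And>n l. 2 \<le> n \<Longrightarrow> real l \<le> 6 * real d * real n powr (1 / real d) \<Longrightarrow>
    1 / lam TYPE('n) \<alpha> \<beta> l \<le> K * (real n powr (\<alpha> / real d) * ln (real n) powr \<beta>)"
    using inverse_lam_bound[OF d(3) \<alpha>, of \<beta>] unfolding d_def by blast
  have "ereal (1 / (2 * K) * real n powr (-\<alpha> / real d) * ln (real n) powr (-\<beta>))
      \<le> quad_error TYPE('n) \<alpha> \<beta> n" if n: "2 \<le> n" for n :: nat
  proof -
    define s where "s = K * (real n powr (\<alpha> / real d) * ln (real n) powr \<beta>)"
    have s: "0 < s" using K(1) n by (simp add: s_def)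
    have eq: "1 / (2 * K) * real n powr (-\<alpha> / real d) * ln (real n) powr (-\<beta>) = 1 / (2 * s)"
      by (simp add: s_def powr_minus field_simps)
    define r where "r = real n powr (1 / real d)"
    have r: "1 \<le> r" unfolding r_def using n d by (intro ge_one_powr_ge_zero) auto
    \<comment> \<open>The lower bound \<open>2 * r\<close> makes the dimension at least
      \<open>(2 r) ^ d \<ge> 2 n\<close>. The upper bound \<open>3 * r\<close>, valid since
      \<open>r \<ge> 1\<close>, keeps all degrees up to \<open>2 * N\<close> within the factor 6 of
      \<open>inverse_lam_bound\<close>.\<close>
    define M where "M = nat \<lceil>2 * r\<rceil>"
    have M: "2 * r \<le> real M" "real M \<le> 3 * r" using r by (auto simp: M_def) linarith+
    define N where "N = d * M"
    obtain D and e :: "nat \<Rightarrow> real^'n \<Rightarrow> real" where e: "hpoly_basis N D e"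
      by (rule hpoly_basis_exists)
    have D: "2 * real n \<le> real D"
    proof -
      have "2 * real n \<le> 2 ^ d * r ^ d"
      proof (rule mult_mono)
        show "2 \<le> (2::real) ^ d" using d power_increasing[of 1 d "2::real"] by simp
        show "real n \<le> r ^ d" using n d by (simp add: r_def powr_power)
      qed (use r in auto)
      also have "\<dots> \<le> real (Suc M) ^ d"
        unfolding power_mult_distrib[symmetric] using M r by (intro power_mono) auto
      also have "\<dots> \<le> real D"
        using hpoly_basis_card[of M D e] e unfolding N_def d_def
        by (simp only: of_nat_power[symmetric] of_nat_le_iff)
      finally show ?thesis .
    qed
    have D0: "0 < real D" using D n by simp
    have lam: "1 / lam TYPE('n) \<alpha> \<beta> l \<le> s" if "l \<le> 2 * N" for l
    proof -
      have "real l \<le> 2 * (real d * real M)" using that by (simp add: N_def flip: of_nat_mult)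
      also have "\<dots> \<le> 2 * (real d * (3 * r))" using M(2) by (intro mult_left_mono) auto
      finally show ?thesis unfolding s_def using K(2)[OF n, of l] by (simp add: r_def)
    qed
    show ?thesis
      unfolding quad_error_def eq
    proof (rule INF_greatest, clarify)
      fix c :: "nat \<Rightarrow> real" and x :: "nat \<Rightarrow> real^'n"
      assume x: "\<forall>j<n. x j \<in> sphere 0 1"
      then obtain q where q: "hpoly (2 * N) q" "\<And>y. norm y = 1 \<Longrightarrow> 0 \<le> q y \<and> q y \<le> real D"
        "\<And>j. j < n \<Longrightarrow> q (x j) = 0" "real D - real n \<le> (LINT y|sphere_measure. q y)"
        using fooling_polynomial[OF e, of n x] by auto
      \<comment> \<open>Dividing by \<open>D\<close> bounds the function by 1 on the sphere and
        leaves an integral of at least 1/2, as \<open>D \<ge> 2 n\<close>; the further division by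
        \<open>s\<close> brings it into the unit ball.\<close>
      define f where "f = (\<lambda>y. 1 / (real D * s) * q y)"
      have "f \<in> H_unit_ball TYPE('n) \<alpha> \<beta>"
      proof (rule hpoly_in_H_unit_ball[OF d(3) _ s lam])
        show "hpoly (2 * N) f" unfolding f_def by (rule hpoly_scale[OF q(1)])
        fix y :: "real^'n" assume "norm y = 1"
        then show "\<bar>f y\<bar> \<le> 1 / s" using q(2)[of y] s D0 by (simp add: f_def abs_mult field_simps)
      qed
      moreover have "1 / (2 * s) \<le> \<bar>(LINT y|sphere_measure. f y) - (\<Sum>j<n. c j * f (x j))\<bar>"
      proof -
        have "real D / 2 \<le> (LINT y|sphere_measure. q y)" using q(4) D by linarith
        then have "1 / (real D * s) * (real D / 2) \<le> 1 / (real D * s) * (LINT y|sphere_measure. q y)"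
          using s D0 by (intro mult_left_mono) auto
        then have "1 / (2 * s) \<le> (LINT y|sphere_measure. f y)"
          using D0 by (simp add: f_def)
        moreover have "(\<Sum>j<n. c j * f (x j)) = 0" using q(3) by (simp add: f_def)
        ultimately show ?thesis by simp
      qed
      ultimately show "ereal (1 / (2 * s)) \<le> (SUP f\<in>H_unit_ball TYPE('n) \<alpha> \<beta>.
          ereal \<bar>(LINT y|sphere_measure. f y) - (\<Sum>j<n. fst (c, x) j * f (snd (c, x) j))\<bar>)"
        by (intro SUP_upper2[of f]) auto
    qed
  qed
  then show ?thesis
    using K(1) d(2) by (intro exI[of _ "1 / (2 * K)"]) simp
qed

end
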